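(* Let $\{(\lambda_{jk},\xi_{jk})\}$ be a family of quadratures on $\mathbb{S}^2$ satisfying the quadrature assumption (Q), and let $\kappa$ be a cutoff function satisfying the cutoff assumption (K) with integer $r>2$ (both spelled out in the context). Let $\mathsf{A}=(A_\ell)_{\ell\in\mathbb{N}_0}$ be a sequence of positive reals with $\sum_{\ell=0}^\infty(2\ell+1)A_\ell<\infty$ such that for some $\beta>0$ and $c_r>0$, $$|\Delta^r_\ell|\le c_r(1+\ell)^{-(1+\beta+r)}\quad\text{for all }\ell\in\mathbb{N}_0,$$ where $\Delta^0_\ell:=\sqrt{A_\ell}$ and $\Delta^i_\ell:=\Delta^{i-1}_{\ell+1}-\Delta^{i-1}_\ell$ for $i\in\mathbb{N}$, and where $r$ is the same as in (K). Then there exists $C>0$ such that for all $j\in\mathbb{N}_0$, all $k=1,\dots,n_j$ and all $s\in\mathbb{S}^2$, the modified needlets $$\psi^{\mathsf{A}}_{jk}(s)=\sqrt{\lambda_{jk}}\sum_{\ell=0}^\infty \kappa\bigl(2^{-j}(2\ell+1)\bigr)\sqrt{A_\ell}\,\frac{2\ell+1}{4\pi}P_\ell(s\cdot\xi_{jk})$$ satisfy $$|\psi^{\mathsf{A}}_{jk}(s)|\le\frac{C2^{-\beta j}}{1+(2^j\theta)^r},\qquad \theta:=d(s,\xi_{jk})\in[0,\pi].$$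
   Context: $\mathbb{S}^2\subset\mathbb{R}^3$ is the unit sphere, $\sigma$ its surface measure with $\sigma(\mathbb{S}^2)=4\pi$, and $d(s,s')=\arccos(s\cdot s')$ is the geodesic distance. $P_\ell$ is the $\ell$-th Legendre polynomial (normalised by $P_\ell(1)=1$). Polynomials on $\mathbb{S}^2$ are restrictions of polynomials on $\mathbb{R}^3$. Quadrature assumption (Q): for each $j\in\mathbb{N}_0$ there are $n_j\in\mathbb{N}$, weights $\lambda_{jk}>0$ and points $\xi_{jk}\in\mathbb{S}^2$, $k=1,\dots,n_j$, such that: $\int_{\mathbb{S}^2} f\,d\sigma=\sum_{k=1}^{n_j}\lambda_{jk}f(\xi_{jk})$ for every polynomial $f$ of degree at most $2(2^j-1)$; $n_j\le C2^{2j}$ with $C>0$ independent of $j$; with $h_j=\sup_{s\in\mathbb{S}^2}\min_{k}d(s,\xi_{jk})$, one has $\frac{h_j}{4}\le h_{j+1}\le\frac{h_j}{2}$ and $h_j\le d(\xi_{jk},\xi_{jk'})$ for all $k\ne k'$; and $\lambda_{jk}\le c\,2^{-2j}$ with $c>0$ independent of $j$. Cutoff assumption (K): $\kappa\in C^r(\mathbb{R})$ with an integer $r>2$, $\operatorname{supp}\kappa=[\frac12,2]$, and $|\kappa(t)|^2+|\kappa(2t)|^2=1$ for $t\in[\frac12,1]$. *)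

theory Defs
  imports "HOL-Analysis.Analysis" "HOL-Computational_Algebra.Polynomial"
begin

abbreviation S2 :: "(real ^ 3) set" where
  "S2 \<equiv> sphere 0 1"

definition geodist :: "real ^ 3 \<Rightarrow> real ^ 3 \<Rightarrow> real" where
  "geodist s s' = arccos (s \<bullet> s')"

definition spherical_coords :: "real \<times> real \<Rightarrow> real ^ 3" where
  "spherical_coords = (\<lambda>(\<theta>, \<phi>). vector [sin \<theta> * cos \<phi>, sin \<theta> * sin \<phi>, cos \<theta>])"

text \<open>The factor \<open>sin \<theta>\<close> is the surface area element of this parametrisation. The underlying
  space of the measure is the sphere itself, not the ambient space.\<close>

definition sphere_measure :: "(real ^ 3) measure" where
  "sphere_measure =
     distr
       (density (lborel :: (real \<times> real) measure)
          (\<lambda>(\<theta>, \<phi>). indicator ({0..pi} \<times> {0..2 * pi}) (\<theta>, \<phi>) * ennreal (sin \<theta>)))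
       (restrict_space borel S2) spherical_coords"

lemma spherical_coords_measurable:
  "spherical_coords \<in> borel \<rightarrow>\<^sub>M restrict_space borel S2"
proof (rule measurable_restrict_space2)
  have "norm (spherical_coords z) = 1" for z
  proof -
    have "(sin a * cos b)\<^sup>2 + (sin a * sin b)\<^sup>2 + (cos a)\<^sup>2 = 1" for a b :: real
    proof -
      have "(sin a * cos b)\<^sup>2 + (sin a * sin b)\<^sup>2 + (cos a)\<^sup>2
          = (sin a)\<^sup>2 * ((sin b)\<^sup>2 + (cos b)\<^sup>2) + (cos a)\<^sup>2"
        by (simp only: power_mult_distrib) algebra
      then show ?thesis by simp
    qed
    then show ?thesis
      by (cases z) (simp add: spherical_coords_def norm_vec_def L2_set_def sum_3)
  qed
  then show "spherical_coords \<in> space borel \<rightarrow> S2" by simp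
  have "continuous_on UNIV spherical_coords"
  proof (subst continuous_on_componentwise, intro ballI)
    fix b :: "real ^ 3" assume "b \<in> Basis"
    then obtain i :: 3 where b: "b = axis i 1" by (auto simp: Basis_vec_def)
    show "continuous_on UNIV (\<lambda>z. spherical_coords z \<bullet> b)"
      using exhaust_3[of i]
      by (elim disjE)
         (simp_all add: b inner_axis spherical_coords_def case_prod_unfold continuous_intros)
  qed
  then show "spherical_coords \<in> borel_measurable borel"
    by (rule borel_measurable_continuous_onI)
qed

lemma emeasure_sphere_measure: "emeasure sphere_measure S2 = ennreal (4 * pi)"
proof -
  have [measurable]: "spherical_coords \<in> borel \<rightarrow>\<^sub>M restrict_space borel S2"
    by (rule spherical_coords_measurable)
  have inS: "spherical_coords z \<in> S2" for z
    using measurable_space[OF spherical_coords_measurable, of z] by (simp add: space_restrict_space)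
  have sp: "S2 \<in> sets (restrict_space borel S2)"
    using sets.top[of "restrict_space borel S2"] by (simp add: space_restrict_space)
  have D: "(\<lambda>(\<theta>, \<phi>). indicator ({0..pi} \<times> {0..2 * pi}) (\<theta>, \<phi>) * ennreal (sin \<theta>))
      \<in> borel_measurable (lborel :: (real \<times> real) measure)"
    unfolding case_prod_unfold lborel_prod[symmetric] by measurable
  have "emeasure sphere_measure S2
      = (\<integral>\<^sup>+ z. (case z of (\<theta>, \<phi>) \<Rightarrow> indicator ({0..pi} \<times> {0..2 * pi}) (\<theta>, \<phi>) * ennreal (sin \<theta>))
          \<partial>(lborel :: (real \<times> real) measure))"
    unfolding sphere_measure_def
    using inS sp D
    by (subst emeasure_distr) (auto simp: emeasure_density vimage_def)
  also have "\<dots> = (\<integral>\<^sup>+ z. (case z of (\<theta>, \<phi>) \<Rightarrow>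
        (ennreal (sin \<theta>) * indicator {0..pi} \<theta>) * indicator {0..2 * pi} \<phi>)
          \<partial>(lborel \<Otimes>\<^sub>M lborel))"
    unfolding lborel_prod by (intro nn_integral_cong) (auto simp: indicator_def split: prod.splits)
  also have "\<dots> = (\<integral>\<^sup>+ \<theta>. (\<integral>\<^sup>+ \<phi>. (ennreal (sin \<theta>) * indicator {0..pi} \<theta>) *
        indicator {0..2 * pi} \<phi> \<partial>lborel) \<partial>lborel)"
    by (subst lborel.nn_integral_fst[symmetric]) (auto simp: case_prod_unfold)
  also have "\<dots> = (\<integral>\<^sup>+ \<theta>. ennreal (sin \<theta>) * indicator {0..pi} \<theta> \<partial>lborel) * ennreal (2 * pi)"
    by (simp add: nn_integral_cmult nn_integral_multc)
  also have "(\<integral>\<^sup>+ \<theta>. ennreal (sin \<theta>) * indicator {0..pi} \<theta> \<partial>lborel) = ennreal (- cos pi - - cos 0)"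
    by (rule nn_integral_FTC_Icc) (auto intro!: derivative_eq_intros sin_ge_zero)
  also have "\<dots> * ennreal (2 * pi) = ennreal (4 * pi)"
    by (subst ennreal_mult[symmetric]) auto
  finally show ?thesis .
qed

text \<open>Restrictions to the sphere are implicit: only values on the sphere are ever used.\<close>

definition poly3_degree_le :: "nat \<Rightarrow> (real ^ 3 \<Rightarrow> real) \<Rightarrow> bool" where
  "poly3_degree_le N f \<longleftrightarrow>
     (\<exists>a :: nat \<Rightarrow> nat \<Rightarrow> nat \<Rightarrow> real. \<forall>x.
        f x = (\<Sum>(p, q, m) \<in> {(p, q, m). p + q + m \<le> N}. a p q m * x $ 1 ^ p * x $ 2 ^ q * x $ 3 ^ m))"

lemma finite_exponents: "finite {(p, q, m). p + q + m \<le> (N :: nat)}"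
  by (rule finite_subset[of _ "{..N} \<times> {..N} \<times> {..N}"]) auto

text \<open>Legendre polynomials by Bonnet's recursion
  \<open>(l + 2) P\<^bsub>l+2\<^esub> = (2l + 3) x P\<^bsub>l+1\<^esub> - (l + 1) P\<^bsub>l\<^esub>\<close>.\<close>

fun legendre_poly :: "nat \<Rightarrow> real poly" where
  "legendre_poly 0 = 1"
| "legendre_poly (Suc 0) = [:0, 1:]"
| "legendre_poly (Suc (Suc l)) =
     smult (1 / (real l + 2))
       (smult (2 * real l + 3) ([:0, 1:] * legendre_poly (Suc l)) - smult (real l + 1) (legendre_poly l))"

lemma legendre_poly_at_1: "poly (legendre_poly l) 1 = 1"
  by (induction l rule: legendre_poly.induct) (simp_all add: field_simps)

definition mesh_norm :: "(nat \<Rightarrow> nat) \<Rightarrow> (nat \<Rightarrow> nat \<Rightarrow> real ^ 3) \<Rightarrow> nat \<Rightarrow> real" where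
  "mesh_norm n \<xi> j = (SUP s\<in>S2. Min ((\<lambda>k. geodist s (\<xi> j k)) ` {1..n j}))"

definition quadrature_family ::
    "(nat \<Rightarrow> nat) \<Rightarrow> (nat \<Rightarrow> nat \<Rightarrow> real) \<Rightarrow> (nat \<Rightarrow> nat \<Rightarrow> real ^ 3) \<Rightarrow> bool" where
  "quadrature_family n w \<xi> \<longleftrightarrow>
     (\<forall>j. n j \<ge> 1) \<and>
     (\<forall>j. \<forall>k\<in>{1..n j}. w j k > 0 \<and> \<xi> j k \<in> S2) \<and>
     (\<forall>j f. poly3_degree_le (2 * (2 ^ j - 1)) f \<longrightarrow>
        (\<integral>s. f s \<partial>sphere_measure) = (\<Sum>k=1..n j. w j k * f (\<xi> j k))) \<and>
     (\<exists>C>0. \<forall>j. real (n j) \<le> C * 2 ^ (2 * j)) \<and>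
     (\<forall>j. mesh_norm n \<xi> j / 4 \<le> mesh_norm n \<xi> (Suc j) \<and>
          mesh_norm n \<xi> (Suc j) \<le> mesh_norm n \<xi> j / 2) \<and>
     (\<forall>j. \<forall>k\<in>{1..n j}. \<forall>k'\<in>{1..n j}. k \<noteq> k' \<longrightarrow>
          mesh_norm n \<xi> j \<le> geodist (\<xi> j k) (\<xi> j k')) \<and>
     (\<exists>c>0. \<forall>j. \<forall>k\<in>{1..n j}. w j k \<le> c / 2 ^ (2 * j))"

definition C_r :: "nat \<Rightarrow> (real \<Rightarrow> real) \<Rightarrow> bool" where
  "C_r r f \<longleftrightarrow>
     (\<forall>i<r. (deriv ^^ i) f differentiable_on UNIV) \<and> continuous_on UNIV ((deriv ^^ r) f)"

definition cutoff :: "nat \<Rightarrow> (real \<Rightarrow> real) \<Rightarrow> bool" where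
  "cutoff r \<kappa> \<longleftrightarrow>
     r > 2 \<and> C_r r \<kappa> \<and> closure {t. \<kappa> t \<noteq> 0} = {1 / 2..2} \<and>
     (\<forall>t\<in>{1 / 2..1}. \<bar>\<kappa> t\<bar>\<^sup>2 + \<bar>\<kappa> (2 * t)\<bar>\<^sup>2 = 1)"

primrec fwd_diff :: "nat \<Rightarrow> (nat \<Rightarrow> real) \<Rightarrow> nat \<Rightarrow> real" where
  "fwd_diff 0 a l = a l"
| "fwd_diff (Suc i) a l = fwd_diff i a (l + 1) - fwd_diff i a l"

text \<open>The parameters \<open>\<omega>\<close> and \<open>\<xi>\<close> are one weight and one point, i.e. those with a fixed index pair;
  for a cutoff \<open>\<kappa>\<close> the series has only finitely many nonzero terms.\<close>

definition needlet ::
    "(real \<Rightarrow> real) \<Rightarrow> (nat \<Rightarrow> real) \<Rightarrow> nat \<Rightarrow> real \<Rightarrow> real ^ 3 \<Rightarrow> real ^ 3 \<Rightarrow> real" where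
  "needlet \<kappa> A j \<omega> \<xi> s =
     sqrt \<omega> * (\<Sum>l. \<kappa> ((2 * real l + 1) / 2 ^ j) * sqrt (A l) * ((2 * real l + 1) / (4 * pi))
                     * poly (legendre_poly l) (s \<bullet> \<xi>))"

end

theory Submission
  imports Defs
begin

text \<open>Write \<open>N = 2\<^sup>j\<close>, \<open>x = cos \<theta>\<close> and \<open>b\<^sub>l = \<kappa> ((2 l + 1) / N) \<surd>A\<^sub>l\<close>. Up to the factor
  \<open>\<surd>\<lambda> / (4 \<pi>) = O (1 / N)\<close>, the needlet is the Legendre sum \<open>\<Sum>\<^sub>l b\<^sub>l (2 l + 1) P\<^sub>l(x)\<close>. It has
  \<open>O(N)\<close> terms of size \<open>O(N\<^bsup>-\<beta>\<^esup>)\<close>, and it has to be shown that it decays like \<open>(N \<theta>)\<^bsup>-r\<^esup>\<close>.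

  The decay comes from summation by parts. Bonnet's recursion says that multiplication by \<open>1 - x\<close> acts
  on \<open>(2 l + 1) P\<^sub>l\<close> as a second order difference operator in \<open>l\<close>; its transpose, \<open>legendre_laplace\<close>,
  acts on the coefficients and looks like minus the sum of half a second difference and
  \<open>1 / (2 l)\<close> times a first difference. Since \<open>1 - x\<close> is comparable to \<open>\<theta>\<^sup>2\<close>, each application trades a factor \<open>\<theta>\<^sup>2\<close> for
  two differences of the coefficients, each of which gains a factor \<open>1 / N\<close>
  (\<open>diff_bounded_legendre_laplace\<close>, \<open>legendre_sum_laplace\<close>). When \<open>r\<close> is even, \<open>r / 2\<close> applications
  and \<open>\<bar>P\<^sub>l\<bar> \<le> 1\<close> suffice. When \<open>r\<close> is odd, one difference is left over; it is spent on a single summation by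
  parts against the Christoffel-Darboux kernel, and the missing half power of \<open>1 - x\<close> is supplied by
  \<open>\<bar>P\<^sub>l - P\<^sub>l\<^sub>+\<^sub>1\<bar> \<le> 2 \<surd>(1 - x)\<close>. These two bounds on Legendre polynomials both follow from the fact that
  the quadratic form \<open>P\<^sub>l\<^sup>2 - 2 x P\<^sub>l P\<^sub>l\<^sub>+\<^sub>1 + P\<^sub>l\<^sub>+\<^sub>1\<^sup>2\<close> does not increase with \<open>l\<close>
  (\<open>legendre_energy_le\<close>). All this is combined in \<open>legendre_sum_localized\<close>.

  The coefficients \<open>b\<^sub>l\<close> are smooth at scale \<open>N\<close> for the following reason. The hypothesis controls only the
  \<open>r\<close>-th differences of \<open>\<surd>A\<^sub>l\<close>, but as \<open>\<surd>A\<^sub>l\<close> tends to \<open>0\<close>, summing from infinity recovers all lower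
  differences with the expected rates (\<open>lower_differences_decay\<close>). The differences of the samples of
  \<open>\<kappa>\<close> are \<open>O (N\<^bsup>-i\<^esup>)\<close> by the mean value theorem, and on the support of the samples \<open>l\<close> is comparable
  to \<open>N\<close>, so that the product rule gives differences of \<open>b\<close> of size \<open>N\<^bsup>-(1 + \<beta> + i)\<^esup>\<close>
  (\<open>localized_samples_diff_bounded\<close>).\<close>

section \<open>Forward differences\<close>

lemma fwd_diff_Suc_inner: "fwd_diff (Suc i) a l = fwd_diff i (\<lambda>m. a (Suc m) - a m) l"
  by (induction i arbitrary: l) auto

lemma fwd_diff_Suc_arg: "fwd_diff i (\<lambda>m. a (Suc m)) l = fwd_diff i a (Suc l)"
  by (induction i arbitrary: l) auto

lemma fwd_diff_add: "fwd_diff i (\<lambda>m. a m + b m) l = fwd_diff i a l + fwd_diff i b l"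
  by (induction i arbitrary: l) auto

lemma fwd_diff_uminus: "fwd_diff i (\<lambda>m. - a m) l = - fwd_diff i a l"
  by (induction i arbitrary: l) auto

lemma fwd_diff_eq_0:
  assumes "\<And>m. l \<le> m \<Longrightarrow> m \<le> l + i \<Longrightarrow> a m = 0"
  shows "fwd_diff i a l = 0"
  using assms by (induction i arbitrary: l) auto

lemma fwd_diff_affine_mult:
  "fwd_diff i (\<lambda>m. (p * real m + q) * u m) l
     = (p * real l + q) * fwd_diff i u l + p * real i * fwd_diff (i - 1) u (Suc l)"
proof (induction i arbitrary: l)
  case 0
  then show ?case by simp
next
  case (Suc i)
  have "real i * (fwd_diff (i - 1) u (Suc (l + 1)) - fwd_diff (i - 1) u (Suc l)) = real i * fwd_diff i u (Suc l)"
    by (cases i) auto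
  then have "p * real i * (fwd_diff (i - 1) u (Suc (l + 1)) - fwd_diff (i - 1) u (Suc l)) = p * real i * fwd_diff i u (Suc l)"
    by (simp add: mult.assoc)
  then show ?case
    unfolding fwd_diff.simps Suc.IH by (simp add: algebra_simps)
qed

text \<open>The discrete Leibniz rule has \<open>2\<^sup>n\<close> terms, each of size \<open>F G q\<^sup>n\<close>. Since \<open>F\<close> and \<open>G\<close> are arbitrary,
  the induction needs only the product rule for one difference, with \<open>F\<close> or \<open>G\<close> replaced by
  \<open>F q\<close> or \<open>G q\<close>.\<close>

lemma fwd_diff_mult_bound:
  assumes "\<And>i m. i \<le> n \<Longrightarrow> l \<le> m \<Longrightarrow> \<bar>fwd_diff i f m\<bar> \<le> F * q ^ i"
    and "\<And>i m. i \<le> n \<Longrightarrow> l \<le> m \<Longrightarrow> \<bar>fwd_diff i g m\<bar> \<le> G * q ^ i"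
  shows "\<bar>fwd_diff n (\<lambda>m. f m * g m) l\<bar> \<le> F * G * (2 * q) ^ n"
  using assms
proof (induction n arbitrary: f g F G)
  case 0
  have "\<bar>f l\<bar> \<le> F" "\<bar>g l\<bar> \<le> G"
    using 0(1)[of 0 l] 0(2)[of 0 l] by simp_all
  moreover from this have "0 \<le> F" by linarith
  ultimately show ?case by (simp add: abs_mult mult_mono)
next
  case (Suc n)
  have *: "\<bar>fwd_diff n (\<lambda>m. f m * (g (Suc m) - g m)) l\<bar> \<le> F * (G * q) * (2 * q) ^ n"
  proof (rule Suc.IH)
    fix i m assume "i \<le> n" "l \<le> m"
    then show "\<bar>fwd_diff i f m\<bar> \<le> F * q ^ i" by (intro Suc.prems) auto
    show "\<bar>fwd_diff i (\<lambda>m. g (Suc m) - g m) m\<bar> \<le> G * q * q ^ i"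
      using Suc.prems(2)[of "Suc i" m] \<open>i \<le> n\<close> \<open>l \<le> m\<close>
      by (simp only: fwd_diff_Suc_inner) (simp add: mult.assoc)
  qed
  have **: "\<bar>fwd_diff n (\<lambda>m. (f (Suc m) - f m) * g (Suc m)) l\<bar> \<le> F * q * G * (2 * q) ^ n"
  proof (rule Suc.IH)
    fix i m assume "i \<le> n" "l \<le> m"
    then show "\<bar>fwd_diff i (\<lambda>m. g (Suc m)) m\<bar> \<le> G * q ^ i"
      by (simp only: fwd_diff_Suc_arg) (intro Suc.prems, auto)
    show "\<bar>fwd_diff i (\<lambda>m. f (Suc m) - f m) m\<bar> \<le> F * q * q ^ i"
      using Suc.prems(1)[of "Suc i" m] \<open>i \<le> n\<close> \<open>l \<le> m\<close>
      by (simp only: fwd_diff_Suc_inner) (simp add: mult.assoc)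
  qed
  have "fwd_diff (Suc n) (\<lambda>m. f m * g m) l
      = fwd_diff n (\<lambda>m. f m * (g (Suc m) - g m) + (f (Suc m) - f m) * g (Suc m)) l"
    unfolding fwd_diff_Suc_inner by (rule arg_cong[of _ _ "\<lambda>h. fwd_diff n h l"]) (auto simp: algebra_simps)
  then have "fwd_diff (Suc n) (\<lambda>m. f m * g m) l
      = fwd_diff n (\<lambda>m. f m * (g (Suc m) - g m)) l + fwd_diff n (\<lambda>m. (f (Suc m) - f m) * g (Suc m)) l"
    by (simp only: fwd_diff_add)
  with * ** show ?case by (simp add: algebra_simps)
qed

text \<open>\<open>F i\<close> plays the role of the \<open>i\<close>-th derivative of \<open>F 0\<close>. One difference commutes with differentiation,
  so it can be applied to the whole family; the mean value theorem converts it into a factor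
  \<open>h\<close> on the highest derivative.\<close>

lemma fwd_diff_samples_bound:
  fixes F :: "nat \<Rightarrow> real \<Rightarrow> real"
  assumes "\<And>i t. i < n \<Longrightarrow> (F i has_real_derivative F (Suc i) t) (at t)"
    and "\<And>t. \<bar>F n t\<bar> \<le> K" and "h > 0"
  shows "\<bar>fwd_diff n (\<lambda>l. F 0 (t + real l * h)) m\<bar> \<le> K * h ^ n"
  using assms(1,2)
proof (induction n arbitrary: F K)
  case 0
  then show ?case by simp
next
  case (Suc n)
  define G where "G i t = F i (t + h) - F i t" for i t
  have "\<bar>fwd_diff n (\<lambda>l. G 0 (t + real l * h)) m\<bar> \<le> (K * h) * h ^ n"
  proof (rule Suc.IH)
    fix i t assume "i < n"
    then have d: "(F i has_real_derivative F (Suc i) t) (at t)" for t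
      by (intro Suc.prems) auto
    show "(G i has_real_derivative G (Suc i) t) (at t)"
      unfolding G_def
      by (intro DERIV_diff d DERIV_shift[THEN iffD1])
  next
    fix t
    have "\<exists>z. t < z \<and> z < t + h \<and> F n (t + h) - F n t = (t + h - t) * F (Suc n) z"
      using \<open>h > 0\<close> Suc.prems(1) by (intro MVT2) auto
    then obtain z where "G n t = h * F (Suc n) z" unfolding G_def by auto
    then show "\<bar>G n t\<bar> \<le> K * h"
      using Suc.prems(2)[of z] \<open>h > 0\<close> by (simp add: abs_mult)
  qed
  also have "(\<lambda>l. G 0 (t + real l * h)) = (\<lambda>l. F 0 (t + real (Suc l) * h) - F 0 (t + real l * h))"
    by (simp add: G_def fun_eq_iff algebra_simps)
  finally show ?case
    unfolding fwd_diff_Suc_inner by (simp add: mult.assoc)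
qed

text \<open>By the mean value theorem the differences of \<open>C (1 + l)\<^bsup>-\<gamma>\<^esup>\<close> dominate those of \<open>d\<close>. Hence
  \<open>\<bar>d\<^sub>l\<bar> - C (1 + l)\<^bsup>-\<gamma>\<^esup>\<close> increases, and its limit is \<open>0\<close>.\<close>

lemma tail_decay_of_difference_decay:
  fixes d :: "nat \<Rightarrow> real"
  assumes lim: "d \<longlonglongrightarrow> 0" and "\<gamma> > 0"
    and diff: "\<And>l. \<bar>d (Suc l) - d l\<bar> \<le> c * (1 + real l) powr (- (\<gamma> + 1))"
  shows "\<bar>d l\<bar> \<le> c * 2 powr (\<gamma> + 1) / \<gamma> * (1 + real l) powr (- \<gamma>)"
proof -
  define C where "C = c * 2 powr (\<gamma> + 1) / \<gamma>"
  have "c \<ge> 0" using diff[of 0] by simp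
  then have "C \<ge> 0" using \<open>\<gamma> > 0\<close> by (simp add: C_def)
  have step: "c * (1 + real l) powr (- (\<gamma> + 1)) \<le> C * ((1 + real l) powr (- \<gamma>) - (1 + real (Suc l)) powr (- \<gamma>))" for l
  proof -
    have "\<exists>z. 1 + real l < z \<and> z < 2 + real l \<and>
       (2 + real l) powr (- \<gamma>) - (1 + real l) powr (- \<gamma>) = (2 + real l - (1 + real l)) * (- \<gamma> * z powr (- (\<gamma> + 1)))"
      using has_real_derivative_powr[of _ "- \<gamma>"] by (intro MVT2) (auto simp del: mult_minus_left)
    then obtain z where z: "1 + real l < z" "z < 2 + real l"
      and "(1 + real l) powr (- \<gamma>) - (1 + real (Suc l)) powr (- \<gamma>) = \<gamma> * z powr (- (\<gamma> + 1))"
      by (force simp: add.commute)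
    moreover have "(2 * (1 + real l)) powr (- (\<gamma> + 1)) \<le> z powr (- (\<gamma> + 1))"
      using z \<open>\<gamma> > 0\<close> by (intro powr_mono2') auto
    moreover have "(2 * (1 + real l)) powr (- (\<gamma> + 1)) = (1 + real l) powr (- (\<gamma> + 1)) / 2 powr (\<gamma> + 1)"
      by (subst powr_mult) (simp_all add: powr_minus_divide[of 2] del: minus_add_distrib)
    ultimately have *: "\<gamma> * ((1 + real l) powr (- (\<gamma> + 1)) / 2 powr (\<gamma> + 1))
        \<le> (1 + real l) powr (- \<gamma>) - (1 + real (Suc l)) powr (- \<gamma>)"
      using \<open>\<gamma> > 0\<close> by (simp only: mult_le_cancel_left_pos)
    have "c * (1 + real l) powr (- (\<gamma> + 1)) = C * (\<gamma> * ((1 + real l) powr (- (\<gamma> + 1)) / 2 powr (\<gamma> + 1)))"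
      using \<open>\<gamma> > 0\<close> by (simp add: C_def)
    also have "\<dots> \<le> C * ((1 + real l) powr (- \<gamma>) - (1 + real (Suc l)) powr (- \<gamma>))"
      using * \<open>C \<ge> 0\<close> by (rule mult_left_mono)
    finally show ?thesis .
  qed
  define g where "g l = \<bar>d l\<bar> - C * (1 + real l) powr (- \<gamma>)" for l
  have "g l \<le> g (Suc l)" for l
    using step[of l] diff[of l] by (simp add: g_def right_diff_distrib)
  then have "incseq g" by (rule incseq_SucI)
  moreover have "(\<lambda>l. (1 + real l) powr (- \<gamma>)) \<longlonglongrightarrow> 0"
    using \<open>\<gamma> > 0\<close> by (intro tendsto_neg_powr filterlim_tendsto_add_at_top[OF tendsto_const] filterlim_real_sequentially) auto
  then have "g \<longlonglongrightarrow> \<bar>0\<bar> - C * 0" unfolding g_def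
    by (intro tendsto_intros lim)
  ultimately have "g l \<le> 0" using incseq_le[of g 0 l] by simp
  then show ?thesis by (simp add: g_def C_def)
qed

lemma lower_differences_decay:
  fixes a :: "nat \<Rightarrow> real"
  assumes lim: "a \<longlonglongrightarrow> 0" and "\<beta> > 0"
    and diff: "\<And>l. \<bar>fwd_diff r a l\<bar> \<le> c * (1 + real l) powr (- (1 + \<beta> + real r))"
  shows "\<exists>C>0. \<forall>i\<le>r. \<forall>l. \<bar>fwd_diff i a l\<bar> \<le> C * (1 + real l) powr (- (1 + \<beta> + real i))"
proof -
  have tends: "fwd_diff i a \<longlonglongrightarrow> 0" for i
  proof (induction i)
    case 0
    then show ?case using lim by (simp add: fun_eq_iff[THEN iffD2])
  next
    case (Suc i)
    from tendsto_diff[OF LIMSEQ_Suc[OF Suc] Suc] show ?case by simp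
  qed
  have each: "\<exists>C. \<forall>l. \<bar>fwd_diff i a l\<bar> \<le> C * (1 + real l) powr (- (1 + \<beta> + real i))" if "i \<le> r" for i
    using that
  proof (induction i rule: inc_induct)
    case base
    then show ?case using diff by blast
  next
    case (step i)
    then obtain C where "\<And>l. \<bar>fwd_diff (Suc i) a l\<bar> \<le> C * (1 + real l) powr (- (1 + \<beta> + real (Suc i)))"
      by blast
    then have "\<bar>fwd_diff i a (Suc l) - fwd_diff i a l\<bar> \<le> C * (1 + real l) powr (- ((1 + \<beta> + real i) + 1))" for l
      by (simp add: algebra_simps)
    from tail_decay_of_difference_decay[OF tends _ this] \<open>\<beta> > 0\<close> show ?case by (metis add_pos_nonneg add_pos_pos of_nat_0_le_iff zero_less_one)
  qed
  then obtain C where C: "\<And>i l. i \<le> r \<Longrightarrow> \<bar>fwd_diff i a l\<bar> \<le> C i * (1 + real l) powr (- (1 + \<beta> + real i))"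
    by metis
  define D where "D = 1 + (\<Sum>i\<le>r. \<bar>C i\<bar>)"
  have "C i \<le> D" if "i \<le> r" for i
  proof -
    have "\<bar>C i\<bar> \<le> (\<Sum>i\<le>r. \<bar>C i\<bar>)" using that by (intro member_le_sum) auto
    then show ?thesis by (simp add: D_def)
  qed
  then have "\<bar>fwd_diff i a l\<bar> \<le> D * (1 + real l) powr (- (1 + \<beta> + real i))" if "i \<le> r" for i l
    using C[OF that, of l] that by (meson mult_right_mono order_trans powr_ge_zero)
  moreover have "D > 0" unfolding D_def by (simp add: add_pos_nonneg sum_nonneg)
  ultimately show ?thesis by blast
qed

section \<open>Legendre polynomials\<close>

lemma legendre_rec:
  "(real l + 2) * poly (legendre_poly (Suc (Suc l))) x
     = (2 * real l + 3) * x * poly (legendre_poly (Suc l)) x - (real l + 1) * poly (legendre_poly l) x"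
proof -
  have *: "real l + 2 \<noteq> 0" by linarith
  have "poly (legendre_poly (Suc (Suc l))) x
     = ((2 * real l + 3) * x * poly (legendre_poly (Suc l)) x - (real l + 1) * poly (legendre_poly l) x) / (real l + 2)"
    by (simp add: algebra_simps add_divide_distrib diff_divide_distrib)
  then show ?thesis using * by (simp add: nonzero_eq_divide_eq mult.commute del: legendre_poly.simps)
qed

lemma legendre_rec':
  "(real l + 1) * poly (legendre_poly (Suc l)) x + real l * poly (legendre_poly (l - 1)) x
     = (2 * real l + 1) * x * poly (legendre_poly l) x"
proof (cases l)
  case 0
  then show ?thesis by simp
next
  case (Suc k)
  then show ?thesis using legendre_rec[of k x] by (simp add: algebra_simps del: legendre_poly.simps)
qed

text \<open>Bonnet's recursion gives, with \<open>y = x P\<^sub>l\<^sub>+\<^sub>1 - P\<^sub>l\<close>, that \<open>P\<^sub>l\<^sub>+\<^sub>2 - P\<^sub>l\<close> is a positive and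
  \<open>P\<^sub>l\<^sub>+\<^sub>2 + P\<^sub>l - 2 x P\<^sub>l\<^sub>+\<^sub>1\<close> a negative multiple of \<open>y\<close>. Their product is the increment of the left-hand
  side from \<open>l\<close> to \<open>l + 1\<close>; at \<open>l = 0\<close> the left-hand side equals \<open>1 - x\<^sup>2\<close>.\<close>

lemma legendre_energy_le:
  fixes x :: real
  defines "P \<equiv> \<lambda>l. poly (legendre_poly l) x"
  shows "(P l)\<^sup>2 - 2 * x * P l * P (Suc l) + (P (Suc l))\<^sup>2 \<le> 1 - x\<^sup>2"
proof (induction l)
  case 0
  then show ?case by (simp add: P_def power2_eq_square)
next
  case (Suc l)
  have "(real l + 2) * P (Suc (Suc l)) = (2 * real l + 3) * x * P (Suc l) - (real l + 1) * P l"
    unfolding P_def by (rule legendre_rec)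
  then have 1: "(real l + 2) * (P (Suc (Suc l)) - P l) = (2 * real l + 3) * (x * P (Suc l) - P l)"
    and 2: "(real l + 2) * (P (Suc (Suc l)) + P l - 2 * x * P (Suc l)) = - (x * P (Suc l) - P l)"
    by (simp_all add: algebra_simps)
  have "(real l + 2)\<^sup>2 * ((P (Suc (Suc l)) - P l) * (P (Suc (Suc l)) + P l - 2 * x * P (Suc l)))
     = ((real l + 2) * (P (Suc (Suc l)) - P l)) * ((real l + 2) * (P (Suc (Suc l)) + P l - 2 * x * P (Suc l)))"
    by (simp add: power2_eq_square mult_ac)
  also have "\<dots> = - ((2 * real l + 3) * (x * P (Suc l) - P l)\<^sup>2)"
    unfolding 1 2 by (simp add: power2_eq_square algebra_simps)
  also have "\<dots> \<le> 0" by simp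
  finally have "(P (Suc (Suc l)) - P l) * (P (Suc (Suc l)) + P l - 2 * x * P (Suc l)) \<le> 0"
    by (simp add: mult_le_0_iff)
  moreover have "(P (Suc (Suc l)) - P l) * (P (Suc (Suc l)) + P l - 2 * x * P (Suc l))
    = ((P (Suc l))\<^sup>2 - 2 * x * P (Suc l) * P (Suc (Suc l)) + (P (Suc (Suc l)))\<^sup>2)
       - ((P l)\<^sup>2 - 2 * x * P l * P (Suc l) + (P (Suc l))\<^sup>2)"
    by (simp add: power2_eq_square algebra_simps)
  ultimately show ?case using Suc by linarith
qed

text \<open>Completing the square, \<open>legendre_energy_le\<close> reads
  \<open>(P\<^sub>l\<^sub>+\<^sub>1 - x P\<^sub>l)\<^sup>2 + (1 - x\<^sup>2) P\<^sub>l\<^sup>2 \<le> 1 - x\<^sup>2\<close>. At \<open>x = \<plusminus>1\<close>, where the factor \<open>1 - x\<^sup>2\<close>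
  cannot be cancelled, the square forces \<open>P\<^sub>l = x\<^sup>l\<close> instead.\<close>

lemma abs_legendre_le_1:
  assumes "\<bar>x\<bar> \<le> 1"
  shows "\<bar>poly (legendre_poly l) x\<bar> \<le> 1"
proof -
  define P where "P l = poly (legendre_poly l) x" for l
  have E: "(P (Suc l) - x * P l)\<^sup>2 + (1 - x\<^sup>2) * (P l)\<^sup>2 \<le> 1 - x\<^sup>2" for l
    using legendre_energy_le[of l x] unfolding P_def by (simp add: power2_eq_square algebra_simps)
  show ?thesis
  proof (cases "x\<^sup>2 = 1")
    case True
    then have "(P (Suc l) - x * P l)\<^sup>2 \<le> 0" for l using E[of l] by simp
    then have "P (Suc l) = x * P l" for l by simp
    moreover have "P 0 = 1" by (simp add: P_def)
    ultimately have "P l = x ^ l" by (induction l) auto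
    then show ?thesis using assms by (simp add: P_def power_abs power_le_one)
  next
    case False
    moreover have "x\<^sup>2 \<le> 1" using assms by (simp add: abs_square_le_1)
    ultimately have pos: "1 - x\<^sup>2 > 0" by simp
    have "(1 - x\<^sup>2) * (P l)\<^sup>2 \<le> (1 - x\<^sup>2) * 1"
      using E[of l] zero_le_power2[of "P (Suc l) - x * P l"] by (simp only: mult_1_right)
    then have "(P l)\<^sup>2 \<le> 1" using pos by (simp only: mult_le_cancel_left_pos)
    then show ?thesis by (simp add: abs_square_le_1 P_def)
  qed
qed

text \<open>The square of the difference is the quadratic form of \<open>legendre_energy_le\<close> minus
  \<open>2 (1 - x) P\<^sub>l P\<^sub>l\<^sub>+\<^sub>1\<close>.\<close>

lemma abs_legendre_diff_le:
  assumes "\<bar>x\<bar> \<le> 1"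
  shows "\<bar>poly (legendre_poly l) x - poly (legendre_poly (Suc l)) x\<bar> \<le> 2 * sqrt (1 - x)"
proof -
  define p q where "p = poly (legendre_poly l) x" and "q = poly (legendre_poly (Suc l)) x"
  have "\<bar>p * q\<bar> \<le> 1"
    using abs_legendre_le_1[OF assms] by (simp add: p_def q_def abs_mult mult_le_one)
  then have "(1 - x) * (- (p * q)) \<le> (1 - x) * 1"
    using assms by (intro mult_left_mono) auto
  moreover have "p\<^sup>2 - 2 * x * p * q + q\<^sup>2 \<le> 1 - x\<^sup>2"
    unfolding p_def q_def by (rule legendre_energy_le)
  moreover have "(p - q)\<^sup>2 = (p\<^sup>2 - 2 * x * p * q + q\<^sup>2) + 2 * ((1 - x) * (- (p * q)))"
    by (simp add: power2_eq_square algebra_simps)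
  moreover have "1 - x\<^sup>2 \<le> 2 * (1 - x)"
    using sum_power2_ge_zero[of "1 - x" 0] by (simp add: power2_eq_square algebra_simps)
  ultimately have "(p - q)\<^sup>2 \<le> 2\<^sup>2 * (1 - x)" by simp
  then have "\<bar>p - q\<bar> \<le> sqrt (2\<^sup>2 * (1 - x))" by (metis real_sqrt_abs real_sqrt_le_mono)
  then show ?thesis by (simp only: real_sqrt_mult p_def q_def) simp
qed

definition legendre_sum :: "(nat \<Rightarrow> real) \<Rightarrow> nat \<Rightarrow> real \<Rightarrow> real" where
  "legendre_sum c L x = (\<Sum>l<L. c l * (2 * real l + 1) * poly (legendre_poly l) x)"

lemma abs_legendre_sum_le:
  assumes "\<bar>x\<bar> \<le> 1" and "\<And>l. l < L \<Longrightarrow> \<bar>c l\<bar> \<le> M"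
  shows "\<bar>legendre_sum c L x\<bar> \<le> M * (real L)\<^sup>2"
proof -
  have "\<bar>legendre_sum c L x\<bar> \<le> (\<Sum>l<L. \<bar>c l * (2 * real l + 1) * poly (legendre_poly l) x\<bar>)"
    unfolding legendre_sum_def by (rule sum_abs)
  also have "\<dots> \<le> (\<Sum>l<L. M * (2 * real l + 1))"
  proof (rule sum_mono)
    fix l assume "l \<in> {..<L}"
    then have "\<bar>c l\<bar> \<le> M" using assms(2) by simp
    moreover from this have "M \<ge> 0" by linarith
    ultimately have "\<bar>c l\<bar> * (2 * real l + 1) * \<bar>poly (legendre_poly l) x\<bar> \<le> M * (2 * real l + 1) * 1"
      by (intro mult_mono abs_legendre_le_1 assms(1)) auto
    then show "\<bar>c l * (2 * real l + 1) * poly (legendre_poly l) x\<bar> \<le> M * (2 * real l + 1)"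
      by (simp add: abs_mult)
  qed
  also have "\<dots> = M * (real L)\<^sup>2"
    by (induction L) (auto simp: power2_eq_square algebra_simps)
  finally show ?thesis .
qed

text \<open>Summation by parts against the Christoffel-Darboux identity
  \<open>(1 - x) \<Sum>\<^bsub>m\<le>l\<^esub> (2 m + 1) P\<^sub>m = (l + 1) (P\<^sub>l - P\<^sub>l\<^sub>+\<^sub>1)\<close>. That identity is the telescoped
  form of Bonnet's recursion, which enters the induction directly.\<close>

lemma legendre_sum_by_parts:
  "(1 - x) * legendre_sum c L x
     = (\<Sum>l<L. (real l + 1) * (c l - c (Suc l)) * (poly (legendre_poly l) x - poly (legendre_poly (Suc l)) x))
       + real L * c L * (poly (legendre_poly (L - 1)) x - poly (legendre_poly L) x)"
proof (induction L)
  case 0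
  then show ?case by (simp add: legendre_sum_def)
next
  case (Suc L)
  define p q r where "p = poly (legendre_poly (L - 1)) x" and "q = poly (legendre_poly L) x"
    and "r = poly (legendre_poly (Suc L)) x"
  have rec: "(real L + 1) * r + real L * p = (2 * real L + 1) * x * q"
    unfolding p_def q_def r_def by (rule legendre_rec')
  have "(1 - x) * (2 * real L + 1) * q = (real L + 1) * (q - r) - real L * (p - q)"
    using rec by (simp add: algebra_simps)
  then have "c L * ((1 - x) * (2 * real L + 1) * q) = c L * ((real L + 1) * (q - r) - real L * (p - q))"
    by simp
  then have "(1 - x) * (c L * (2 * real L + 1) * q) + real L * c L * (p - q)
      = (real L + 1) * (c L - c (Suc L)) * (q - r) + (real L + 1) * c (Suc L) * (q - r)"
    by (simp add: algebra_simps)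
  then show ?case using Suc
    by (simp add: legendre_sum_def distrib_left p_def q_def r_def add_ac del: legendre_poly.simps)
qed

text \<open>The operator on coefficients dual to multiplication of the sum by \<open>1 - x\<close>: by Bonnet's recursion
  \<open>(2 l + 1) x P\<^sub>l = (l + 1) P\<^sub>l\<^sub>+\<^sub>1 + l P\<^sub>l\<^sub>-\<^sub>1\<close>, and collecting the coefficient of
  \<open>(2 l + 1) P\<^sub>l\<close> gives this formula. At \<open>l = 0\<close> the value \<open>c (0 - 1)\<close> has the factor \<open>0\<close>.\<close>

definition legendre_laplace :: "(nat \<Rightarrow> real) \<Rightarrow> nat \<Rightarrow> real" where
  "legendre_laplace c l = c l - (real l * c (l - 1) + (real l + 1) * c (Suc l)) / (2 * real l + 1)"

lemma legendre_laplace_eq: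
  "(2 * real l + 1) * legendre_laplace c l = (2 * real l + 1) * c l - real l * c (l - 1) - (real l + 1) * c (Suc l)"
proof -
  have "2 * real l + 1 \<noteq> 0" by linarith
  then show ?thesis by (simp add: legendre_laplace_def right_diff_distrib)
qed

text \<open>For coefficients that vanish at \<open>L - 1\<close> and \<open>L\<close> the boundary term disappears, and multiplication by
  \<open>1 - x\<close> amounts to applying \<open>legendre_laplace\<close> to the coefficients.\<close>

lemma legendre_sum_laplace:
  "(1 - x) * legendre_sum c L x = legendre_sum (legendre_laplace c) L x
     + real L * (c L * poly (legendre_poly (L - 1)) x - c (L - 1) * poly (legendre_poly L) x)"
proof (induction L)
  case 0
  then show ?case by (simp add: legendre_sum_def)
next
  case (Suc L)
  define p q r where "p = poly (legendre_poly (L - 1)) x" and "q = poly (legendre_poly L) x"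
    and "r = poly (legendre_poly (Suc L)) x"
  have rec: "(real L + 1) * r + real L * p = (2 * real L + 1) * x * q"
    unfolding p_def q_def r_def by (rule legendre_rec')
  have "(1 - x) * (2 * real L + 1) * q = (2 * real L + 1) * q - (real L + 1) * r - real L * p"
    using rec by (simp add: algebra_simps)
  then have "c L * ((1 - x) * (2 * real L + 1) * q) = c L * ((2 * real L + 1) * q - (real L + 1) * r - real L * p)"
    by simp
  moreover have "((2 * real L + 1) * legendre_laplace c L) * q = ((2 * real L + 1) * c L - real L * c (L - 1) - (real L + 1) * c (Suc L)) * q"
    by (simp only: legendre_laplace_eq)
  ultimately have "(1 - x) * (c L * (2 * real L + 1) * q) + real L * (c L * p - c (L - 1) * q)
      = legendre_laplace c L * (2 * real L + 1) * q + (real L + 1) * (c (Suc L) * q - c L * r)"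
    by (simp add: algebra_simps)
  then show ?case using Suc
    by (simp add: legendre_sum_def distrib_left p_def q_def r_def add_ac del: legendre_poly.simps)
qed

section \<open>Decay of Legendre sums with smooth coefficients\<close>

text \<open>A discrete symbol class. The exponent is chosen to be \<open>0\<close> for differences of the top order \<open>k\<close>, so
  that only natural powers occur; coefficients concentrated at \<open>l \<approx> N\<close> with \<open>i\<close>-th differences
  of size \<open>B N\<^bsup>-i\<^esup>\<close> belong to the class with \<open>M = O (B N\<^bsup>-k\<^esup>)\<close>.\<close>

definition diff_bounded :: "nat \<Rightarrow> real \<Rightarrow> (nat \<Rightarrow> real) \<Rightarrow> bool" where
  "diff_bounded k M c \<longleftrightarrow> (\<forall>i\<le>k. \<forall>l. \<bar>fwd_diff i c l\<bar> \<le> M * (1 + real l) ^ (k - i))"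

lemma diff_bounded_nonneg: "diff_bounded k M c \<Longrightarrow> M \<ge> 0"
  unfolding diff_bounded_def by (elim allE[of _ k] impE allE[of _ 0]) auto

text \<open>Differences of \<open>d\<close> at \<open>0\<close> are combinations of \<open>d\<^sub>0\<close> and of differences at \<open>1\<close>, so adding one value
  in front of a sequence affects only the constant.\<close>

lemma diff_bounded_unshift:
  assumes "diff_bounded k M (\<lambda>l. d (Suc l))" and "\<bar>d 0\<bar> \<le> M"
  shows "diff_bounded k (2 ^ k * M) d"
  unfolding diff_bounded_def
proof (intro allI impI)
  fix i l :: nat assume "i \<le> k"
  have "M \<ge> 0" using assms(2) by linarith
  have shift: "\<bar>fwd_diff i d (Suc l)\<bar> \<le> M * (1 + real l) ^ (k - i)" if "i \<le> k" for i l
    using assms(1) that unfolding diff_bounded_def fwd_diff_Suc_arg by blast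
  have zero: "\<bar>fwd_diff i d 0\<bar> \<le> 2 ^ i * M" if "i \<le> k" for i
    using that
  proof (induction i)
    case 0
    then show ?case using assms(2) by simp
  next
    case (Suc i)
    have "1 * M \<le> 2 ^ i * M" using \<open>M \<ge> 0\<close> by (intro mult_right_mono) auto
    moreover have "\<bar>fwd_diff i d (Suc 0)\<bar> \<le> M" using shift[of i 0] Suc.prems by simp
    ultimately show ?case using Suc by simp
  qed
  show "\<bar>fwd_diff i d l\<bar> \<le> 2 ^ k * M * (1 + real l) ^ (k - i)"
  proof (cases l)
    case 0
    have "2 ^ i * M \<le> 2 ^ k * M"
      using \<open>M \<ge> 0\<close> \<open>i \<le> k\<close> by (intro mult_right_mono power_increasing) auto
    then show ?thesis using zero[OF \<open>i \<le> k\<close>] 0 by simp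
  next
    case (Suc l')
    have "M * (1 + real l') ^ (k - i) \<le> (2 ^ k * M) * (1 + real l) ^ (k - i)"
      using \<open>M \<ge> 0\<close> Suc mult_right_mono[of 1 "2 ^ k" M] by (intro mult_mono power_mono) auto
    then show ?thesis using shift[OF \<open>i \<le> k\<close>, of l'] Suc by simp
  qed
qed

lemma pow_shift_le: "(2 + real l) ^ e \<le> 2 ^ e * (1 + real l) ^ e"
proof -
  have "(2 + real l) ^ e \<le> (2 * (1 + real l)) ^ e" by (intro power_mono) auto
  then show ?thesis by (simp only: power_mult_distrib)
qed

text \<open>Division by \<open>2 l + 3\<close> lowers the order by one. Instead of estimating the differences of \<open>1 / (2 l + 3)\<close>,
  compare the differences of \<open>u\<close> with those of the product: by \<open>fwd_diff_affine_mult\<close> the \<open>i\<close>-th difference of the product is \<open>(2 l + 3)\<close> times that of \<open>u\<close>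
  plus \<open>2 i\<close> times a difference of \<open>u\<close> of order \<open>i - 1\<close>, which the induction controls.\<close>

lemma diff_bounded_divide_odd:
  assumes "\<And>i l. i \<le> k \<Longrightarrow> \<bar>fwd_diff i (\<lambda>m. (2 * real m + 3) * u m) l\<bar> \<le> D * (1 + real l) ^ (Suc k - i)"
  shows "diff_bounded k ((1 + real k * 2 ^ (k + 2)) ^ k * D) u"
proof -
  define q :: real where "q = 1 + real k * 2 ^ (k + 2)"
  have "D \<ge> 0" using assms[of 0 0] by simp
  have "q \<ge> 1" by (simp add: q_def)
  have "\<bar>fwd_diff i u l\<bar> \<le> q ^ i * D * (1 + real l) ^ (k - i)" if "i \<le> k" for i l
    using that
  proof (induction i arbitrary: l rule: less_induct)
    case (less i)
    define y where "y = (1 + real l) ^ (Suc k - i)"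
    have "y \<ge> 0" by (simp add: y_def)
    have y: "y = (1 + real l) * (1 + real l) ^ (k - i)"
      using less.prems by (simp add: y_def Suc_diff_le)
    have prev: "2 * real i * \<bar>fwd_diff (i - 1) u (Suc l)\<bar> \<le> (q ^ i - 1) * (D * y)"
    proof (cases i)
      case 0
      then show ?thesis by simp
    next
      case (Suc i')
      have "\<bar>fwd_diff i' u (Suc l)\<bar> \<le> q ^ i' * D * (1 + real (Suc l)) ^ (k - i')"
        using less.prems Suc by (intro less.IH) auto
      also have "(1 + real (Suc l)) ^ (k - i') \<le> 2 ^ (k - i') * y"
        using pow_shift_le[of l "k - i'"] Suc by (simp add: y_def)
      also have "\<dots> \<le> 2 ^ (k + 1) * y"
        using \<open>y \<ge> 0\<close> by (intro mult_right_mono power_increasing) auto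
      finally have *: "\<bar>fwd_diff i' u (Suc l)\<bar> \<le> q ^ i' * D * (2 ^ (k + 1) * y)"
        using \<open>D \<ge> 0\<close> \<open>q \<ge> 1\<close> by (simp add: mult_left_mono)
      have "2 * real i * \<bar>fwd_diff i' u (Suc l)\<bar> \<le> 2 * real k * (q ^ i' * D * (2 ^ (k + 1) * y))"
        using less.prems * by (intro mult_mono) auto
      also have "\<dots> = (q - 1) * q ^ i' * (D * y)" by (simp add: q_def)
      also have "\<dots> \<le> (q ^ i - 1) * (D * y)"
        using \<open>D \<ge> 0\<close> \<open>y \<ge> 0\<close> one_le_power[OF \<open>q \<ge> 1\<close>, of i'] Suc
        by (intro mult_right_mono) (auto simp: algebra_simps)
      finally show ?thesis using Suc by simp
    qed
    have "(2 * real l + 3) * fwd_diff i u l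
        = fwd_diff i (\<lambda>m. (2 * real m + 3) * u m) l - 2 * real i * fwd_diff (i - 1) u (Suc l)"
      by (simp only: fwd_diff_affine_mult)
    moreover have "(2 * real l + 3) * \<bar>fwd_diff i u l\<bar> = \<bar>(2 * real l + 3) * fwd_diff i u l\<bar>"
      by (simp add: abs_mult)
    moreover have "2 * real i * \<bar>fwd_diff (i - 1) u (Suc l)\<bar> = \<bar>2 * real i * fwd_diff (i - 1) u (Suc l)\<bar>"
      by (simp add: abs_mult)
    ultimately have "(2 * real l + 3) * \<bar>fwd_diff i u l\<bar>
        \<le> \<bar>fwd_diff i (\<lambda>m. (2 * real m + 3) * u m) l\<bar> + 2 * real i * \<bar>fwd_diff (i - 1) u (Suc l)\<bar>"
      by (simp only: abs_triangle_ineq4)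
    also have "\<dots> \<le> D * y + (q ^ i - 1) * (D * y)"
      using assms[OF less.prems, of l] prev unfolding y_def by (intro add_mono) auto
    also have "\<dots> = (1 + real l) * (q ^ i * D * (1 + real l) ^ (k - i))"
      by (simp add: y algebra_simps)
    also have "\<dots> \<le> (2 * real l + 3) * (q ^ i * D * (1 + real l) ^ (k - i))"
      using \<open>D \<ge> 0\<close> \<open>q \<ge> 1\<close> by (intro mult_right_mono) auto
    finally show ?case by (simp add: mult_le_cancel_left_pos)
  qed
  moreover have "q ^ i * D * (1 + real l) ^ (k - i) \<le> q ^ k * D * (1 + real l) ^ (k - i)" if "i \<le> k" for i l
    using that \<open>D \<ge> 0\<close> \<open>q \<ge> 1\<close> by (intro mult_right_mono power_increasing) auto
  ultimately show ?thesis
    unfolding diff_bounded_def q_def by (meson order_trans)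
qed

text \<open>Multiplied by its denominator, the shifted sequence \<open>legendre_laplace c (l + 1)\<close> is
  \<open>- (\<Delta>c\<^sub>l + (l + 2) \<Delta>\<^sup>2c\<^sub>l)\<close>, an expression in forward differences only. This is why the estimate is made
  for the shifted sequence first and extended to \<open>l = 0\<close> by \<open>diff_bounded_unshift\<close>.\<close>

lemma diff_bounded_legendre_laplace:
  "\<exists>C>0. \<forall>M c. diff_bounded (k + 2) M c \<longrightarrow> diff_bounded k (C * M) (legendre_laplace c)"
proof -
  define D :: real where "D = 3 + real k * 2 ^ (k + 1)"
  define C :: real where "C = 2 ^ k * ((1 + real k * 2 ^ (k + 2)) ^ k * D)"
  have "D > 0" unfolding D_def by (intro add_pos_nonneg) auto
  then have "C > 0" unfolding C_def by (auto simp: add_pos_nonneg)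
  have E1: "(1 + real k * 2 ^ (k + 2)) ^ k \<ge> 1" by (intro one_le_power) auto
  have "diff_bounded k (C * M) (legendre_laplace c)" if c: "diff_bounded (k + 2) M c" for M c
  proof -
    have "M \<ge> 0" using c by (rule diff_bounded_nonneg)
    have cb: "\<bar>fwd_diff i c l\<bar> \<le> M * (1 + real l) ^ (k + 2 - i)" if "i \<le> k + 2" for i l
      using c that unfolding diff_bounded_def by blast
    define u where "u l = legendre_laplace c (Suc l)" for l
    have u: "(\<lambda>l. (2 * real l + 3) * u l)
        = (\<lambda>l. - ((c (Suc l) - c l) + (1 * real l + 2) * fwd_diff 2 c l))"
    proof
      fix l
      show "(2 * real l + 3) * u l = - ((c (Suc l) - c l) + (1 * real l + 2) * fwd_diff 2 c l)"
        using legendre_laplace_eq[of "Suc l" c]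
        by (simp add: u_def numeral_2_eq_2 algebra_simps)
    qed
    have fd2: "fwd_diff i (fwd_diff 2 c) l = fwd_diff (Suc (Suc i)) c l" for i l
      by (induction i arbitrary: l) (auto simp: numeral_2_eq_2)
    have fd1: "fwd_diff i (\<lambda>m. c (Suc m) - c m) l = fwd_diff (Suc i) c l" for i l
      by (simp only: fwd_diff_Suc_inner)
    have "diff_bounded k ((1 + real k * 2 ^ (k + 2)) ^ k * (D * M)) u"
    proof (rule diff_bounded_divide_odd)
      fix i l assume "i \<le> k"
      define y where "y = (1 + real l) ^ (Suc k - i)"
      have "y \<ge> 0" by (simp add: y_def)
      have y: "y = (1 + real l) * (1 + real l) ^ (k - i)"
        using \<open>i \<le> k\<close> by (simp add: y_def Suc_diff_le)
      have 1: "\<bar>fwd_diff (Suc i) c l\<bar> \<le> M * y"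
        using cb[of "Suc i" l] \<open>i \<le> k\<close> by (simp add: y_def)
      have 2: "(real l + 2) * \<bar>fwd_diff (Suc (Suc i)) c l\<bar> \<le> 2 * M * y"
      proof -
        have "(real l + 2) * \<bar>fwd_diff (Suc (Suc i)) c l\<bar> \<le> (2 * (1 + real l)) * (M * (1 + real l) ^ (k - i))"
          using cb[of "Suc (Suc i)" l] \<open>i \<le> k\<close> by (intro mult_mono) auto
        then show ?thesis by (simp add: y algebra_simps del: fwd_diff.simps)
      qed
      have 3: "real i * \<bar>fwd_diff (i - 1) (fwd_diff 2 c) (Suc l)\<bar> \<le> real k * 2 ^ (k + 1) * M * y"
      proof (cases i)
        case 0
        then show ?thesis using \<open>M \<ge> 0\<close> \<open>y \<ge> 0\<close> by simp
      next
        case (Suc i')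
        have "\<bar>fwd_diff (Suc i) c (Suc l)\<bar> \<le> M * (1 + real (Suc l)) ^ (k + 2 - Suc i)"
          using \<open>i \<le> k\<close> by (intro cb) auto
        also have "(1 + real (Suc l)) ^ (k + 2 - Suc i) \<le> 2 ^ (Suc k - i) * y"
          using pow_shift_le[of l "Suc k - i"] by (simp add: y_def)
        also have "\<dots> \<le> 2 ^ (k + 1) * y"
          using \<open>y \<ge> 0\<close> by (intro mult_right_mono power_increasing) auto
        finally have "\<bar>fwd_diff (Suc i) c (Suc l)\<bar> \<le> M * (2 ^ (k + 1) * y)"
          using \<open>M \<ge> 0\<close> by (simp add: mult_left_mono)
        then have "real i * \<bar>fwd_diff (Suc i) c (Suc l)\<bar> \<le> real k * (M * (2 ^ (k + 1) * y))"
          using \<open>i \<le> k\<close> by (intro mult_mono) auto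
        then show ?thesis using Suc by (simp add: fd2 mult_ac del: fwd_diff.simps)
      qed
      have "\<bar>fwd_diff i (\<lambda>l. (2 * real l + 3) * u l) l\<bar>
          = \<bar>fwd_diff (Suc i) c l + (real l + 2) * fwd_diff (Suc (Suc i)) c l
             + real i * fwd_diff (i - 1) (fwd_diff 2 c) (Suc l)\<bar>"
        unfolding u fwd_diff_uminus fwd_diff_add fwd_diff_affine_mult fd1 fd2
        by (simp only: mult_1_left abs_minus_cancel add.assoc)
      also have "\<dots> \<le> \<bar>fwd_diff (Suc i) c l\<bar> + (real l + 2) * \<bar>fwd_diff (Suc (Suc i)) c l\<bar>
             + real i * \<bar>fwd_diff (i - 1) (fwd_diff 2 c) (Suc l)\<bar>"
        by (intro order_trans[OF abs_triangle_ineq] add_mono) (auto simp: abs_mult)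
      also have "\<dots> \<le> M * y + 2 * M * y + real k * 2 ^ (k + 1) * M * y"
        using 1 2 3 by linarith
      also have "\<dots> = D * M * y" by (simp add: D_def algebra_simps)
      finally show "\<bar>fwd_diff i (\<lambda>l. (2 * real l + 3) * u l) l\<bar> \<le> D * M * (1 + real l) ^ (Suc k - i)"
        by (simp add: y_def)
    qed
    moreover have "\<bar>legendre_laplace c 0\<bar> \<le> (1 + real k * 2 ^ (k + 2)) ^ k * (D * M)"
    proof -
      have "\<bar>legendre_laplace c 0\<bar> \<le> M"
        using cb[of 1 0] by (simp add: legendre_laplace_def abs_minus_commute)
      also have "1 * (1 * M) \<le> (1 + real k * 2 ^ (k + 2)) ^ k * (D * M)"
        using E1 \<open>M \<ge> 0\<close> by (intro mult_mono) (auto simp: D_def add_increasing2)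
      then have "M \<le> (1 + real k * 2 ^ (k + 2)) ^ k * (D * M)" by simp
      finally show ?thesis .
    qed
    ultimately have "diff_bounded k (2 ^ k * ((1 + real k * 2 ^ (k + 2)) ^ k * (D * M))) (legendre_laplace c)"
      unfolding u_def by (rule diff_bounded_unshift)
    then show ?thesis by (simp add: C_def mult_ac)
  qed
  with \<open>C > 0\<close> show ?thesis by blast
qed

text \<open>Each step from \<open>k\<close> to \<open>k + 2\<close> uses one factor \<open>1 - x\<close> to replace \<open>c\<close> by \<open>legendre_laplace c\<close>, whose
  support is longer by one. The two base cases are the trivial bound and a single summation by parts, where
  the quotient \<open>2 \<surd>(1 - x) / (1 - x)\<close> accounts for the first power of \<open>\<surd>(1 - x)\<close>.\<close>

lemma legendre_sum_localized:
  "\<exists>C>0. \<forall>M c L x. diff_bounded k M c \<longrightarrow> (\<forall>l\<ge>L. c l = 0) \<longrightarrow> \<bar>x\<bar> \<le> 1 \<longrightarrow>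
     sqrt (1 - x) ^ k * \<bar>legendre_sum c L x\<bar> \<le> C * M * (real (L + k))\<^sup>2"
proof (induction k rule: nat_induct2)
  case 0
  have "\<bar>legendre_sum c L x\<bar> \<le> M * (real L)\<^sup>2" if "diff_bounded 0 M c" "\<bar>x\<bar> \<le> 1" for M c L x
    using that by (intro abs_legendre_sum_le) (auto simp: diff_bounded_def)
  then show ?case by (intro exI[of _ 1]) auto
next
  case 1
  have "sqrt (1 - x) * \<bar>legendre_sum c L x\<bar> \<le> 2 * M * (real (L + 1))\<^sup>2"
    if c: "diff_bounded 1 M c" and supp: "\<forall>l\<ge>L. c l = 0" and x: "\<bar>x\<bar> \<le> 1" for M c L x
  proof (cases "x = 1")
    case True
    then show ?thesis using diff_bounded_nonneg[OF c] by simp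
  next
    case False
    then have pos: "sqrt (1 - x) > 0" using x by simp
    have M: "M \<ge> 0" by (rule diff_bounded_nonneg[OF c])
    define P where "P l = poly (legendre_poly l) x" for l
    have "sqrt (1 - x) * (sqrt (1 - x) * \<bar>legendre_sum c L x\<bar>) = \<bar>(1 - x) * legendre_sum c L x\<bar>"
      using x by (simp add: abs_mult mult.assoc[symmetric])
    also have "\<dots> = \<bar>\<Sum>l<L. (real l + 1) * (c l - c (Suc l)) * (P l - P (Suc l))\<bar>"
      using supp by (simp add: legendre_sum_by_parts P_def)
    also have "\<dots> \<le> (\<Sum>l<L. \<bar>(real l + 1) * (c l - c (Suc l)) * (P l - P (Suc l))\<bar>)"
      by (rule sum_abs)
    also have "\<dots> \<le> (\<Sum>l<L. real (L + 1) * M * (2 * sqrt (1 - x)))"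
    proof (rule sum_mono)
      fix l assume "l \<in> {..<L}"
      have "\<bar>c l - c (Suc l)\<bar> \<le> M"
        using c unfolding diff_bounded_def
        by (elim allE[of _ 1] impE allE[of _ l]) (auto simp: abs_minus_commute)
      then have "(real l + 1) * \<bar>c l - c (Suc l)\<bar> * \<bar>P l - P (Suc l)\<bar> \<le> real (L + 1) * M * (2 * sqrt (1 - x))"
        using \<open>l \<in> {..<L}\<close> M unfolding P_def
        by (intro mult_mono abs_legendre_diff_le x) auto
      then show "\<bar>(real l + 1) * (c l - c (Suc l)) * (P l - P (Suc l))\<bar> \<le> real (L + 1) * M * (2 * sqrt (1 - x))"
        by (simp add: abs_mult)
    qed
    also have "\<dots> = sqrt (1 - x) * (2 * M * (real L * real (L + 1)))" by simp
    also have "\<dots> \<le> sqrt (1 - x) * (2 * M * (real (L + 1))\<^sup>2)"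
      unfolding power2_eq_square using M pos by (intro mult_left_mono mult_right_mono) auto
    finally show ?thesis using pos by (simp add: mult_le_cancel_left_pos)
  qed
  then show ?case by (intro exI[of _ 2]) auto
next
  case (step k)
  then obtain C where C: "C > 0" and IH: "\<And>M c L x. diff_bounded k M c \<Longrightarrow> \<forall>l\<ge>L. c l = 0 \<Longrightarrow> \<bar>x\<bar> \<le> 1 \<Longrightarrow>
     sqrt (1 - x) ^ k * \<bar>legendre_sum c L x\<bar> \<le> C * M * (real (L + k))\<^sup>2" by blast
  obtain D where D: "D > 0" and lap: "\<And>M c. diff_bounded (k + 2) M c \<Longrightarrow> diff_bounded k (D * M) (legendre_laplace c)"
    using diff_bounded_legendre_laplace[of k] by blast
  have "sqrt (1 - x) ^ (k + 2) * \<bar>legendre_sum c L x\<bar> \<le> (C * D) * M * (real (L + (k + 2)))\<^sup>2"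
    if c: "diff_bounded (k + 2) M c" and supp: "\<forall>l\<ge>L. c l = 0" and x: "\<bar>x\<bar> \<le> 1" for M c L x
  proof -
    have M: "M \<ge> 0" by (rule diff_bounded_nonneg[OF c])
    have "legendre_sum c L x = legendre_sum c (Suc L) x" using supp by (simp add: legendre_sum_def)
    then have eq: "(1 - x) * legendre_sum c L x = legendre_sum (legendre_laplace c) (Suc L) x"
      using legendre_sum_laplace[of x c "Suc L"] supp by simp
    have "sqrt (1 - x) ^ (k + 2) * \<bar>legendre_sum c L x\<bar> = sqrt (1 - x) ^ k * \<bar>(1 - x) * legendre_sum c L x\<bar>"
      using x by (simp add: abs_mult)
    also have "\<dots> \<le> C * (D * M) * (real (Suc L + k))\<^sup>2"
      unfolding eq using supp by (intro IH lap c x) (auto simp: legendre_laplace_def)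
    also have "\<dots> \<le> C * (D * M) * (real (L + (k + 2)))\<^sup>2"
      using C D M by (intro mult_left_mono power_mono) auto
    finally show ?thesis by (simp add: mult_ac)
  qed
  then show ?case using C D by (intro exI[of _ "C * D"]) auto
qed

section \<open>Cutoff functions\<close>

lemma cutoff_eq_0:
  assumes "cutoff r \<kappa>" "t \<notin> {1/2..2}"
  shows "\<kappa> t = 0"
  using assms closure_subset[of "{t. \<kappa> t \<noteq> 0}"] unfolding cutoff_def by auto

lemma iterated_deriv_eq_0_outside:
  fixes f :: "real \<Rightarrow> real"
  assumes "closed S" "\<And>t. t \<notin> S \<Longrightarrow> f t = 0" "t \<notin> S"
  shows "(deriv ^^ i) f t = 0"
  using assms(3)
proof (induction i arbitrary: t)
  case 0
  then show ?case using assms(2) by simp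
next
  case (Suc i)
  have "((\<lambda>_. 0) has_field_derivative 0) (at t)" by simp
  then have "((deriv ^^ i) f has_field_derivative 0) (at t)"
    by (rule has_field_derivative_transform_within_open[of _ _ _ "- S"]) (use Suc assms(1) in auto)
  then show ?case by (simp add: DERIV_imp_deriv)
qed

lemma cutoff_deriv_bounded:
  assumes "cutoff r \<kappa>" "i \<le> r"
  shows "\<exists>K. \<forall>t. \<bar>(deriv ^^ i) \<kappa> t\<bar> \<le> K"
proof -
  have "continuous_on UNIV ((deriv ^^ i) \<kappa>)"
    using assms unfolding cutoff_def C_r_def
    by (cases "i = r") (auto intro: differentiable_imp_continuous_on)
  then have "compact ((deriv ^^ i) \<kappa> ` {1/2..2})"
    by (intro compact_continuous_image) (auto intro: continuous_on_subset)
  then obtain K where K: "\<forall>t\<in>{1/2..2}. \<bar>(deriv ^^ i) \<kappa> t\<bar> \<le> K"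
    using compact_imp_bounded bounded_iff by (metis imageI real_norm_def)
  have "\<bar>(deriv ^^ i) \<kappa> t\<bar> \<le> max K 0" for t
  proof (cases "t \<in> {1/2..2}")
    case False
    have "(deriv ^^ i) \<kappa> t = 0"
      by (rule iterated_deriv_eq_0_outside[of "{1/2..2}"]) (use assms cutoff_eq_0 False in auto)
    then show ?thesis by simp
  qed (use K in \<open>simp add: le_max_iff_disj\<close>)
  then show ?thesis by blast
qed

lemma cutoff_samples_diff_bound:
  assumes "cutoff r \<kappa>"
  shows "\<exists>K>0. \<forall>N>0. \<forall>i\<le>r. \<forall>l. \<bar>fwd_diff i (\<lambda>m. \<kappa> ((2 * real m + 1) / N)) l\<bar> \<le> K * (2 / N) ^ i"
proof -
  obtain K where K: "\<And>i t. i \<le> r \<Longrightarrow> \<bar>(deriv ^^ i) \<kappa> t\<bar> \<le> K i"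
    using cutoff_deriv_bounded[OF assms] by metis
  define D where "D = 1 + (\<Sum>i\<le>r. \<bar>K i\<bar>)"
  have "D > 0" unfolding D_def by (simp add: add_pos_nonneg sum_nonneg)
  have KD: "K i \<le> D" if "i \<le> r" for i
  proof -
    have "\<bar>K i\<bar> \<le> (\<Sum>i\<le>r. \<bar>K i\<bar>)" using that by (intro member_le_sum) auto
    then show ?thesis by (simp add: D_def)
  qed
  have "\<bar>fwd_diff i (\<lambda>m. \<kappa> ((2 * real m + 1) / N)) l\<bar> \<le> D * (2 / N) ^ i" if "N > 0" "i \<le> r" for N i l
  proof -
    have "\<bar>fwd_diff i (\<lambda>m. (deriv ^^ 0) \<kappa> (1 / N + real m * (2 / N))) l\<bar> \<le> D * (2 / N) ^ i"
    proof (rule fwd_diff_samples_bound)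
      fix i' t assume "i' < i"
      then have "(deriv ^^ i') \<kappa> differentiable_on UNIV"
        using assms that unfolding cutoff_def C_r_def by auto
      then have "(deriv ^^ i') \<kappa> differentiable (at t)" by (simp add: differentiable_on_def)
      then show "((deriv ^^ i') \<kappa> has_real_derivative (deriv ^^ Suc i') \<kappa> t) (at t)"
        by (simp add: DERIV_deriv_iff_real_differentiable)
    qed (use that K KD in \<open>auto intro: order_trans\<close>)
    moreover have "1 / N + real m * (2 / N) = (2 * real m + 1) / N" for m
      by (simp add: add_divide_distrib mult.commute)
    ultimately show ?thesis by simp
  qed
  with \<open>D > 0\<close> show ?thesis by blast
qed

lemma cutoff_samples_eq_0:
  assumes "cutoff r \<kappa>" "N > 0" "2 * real m + 1 < N / 2 \<or> 2 * real m + 1 > 2 * N"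
  shows "\<kappa> ((2 * real m + 1) / N) = 0"
proof (rule cutoff_eq_0[OF assms(1)])
  show "(2 * real m + 1) / N \<notin> {1 / 2..2}" using assms(2,3) by (auto simp: field_simps)
qed

text \<open>Where a difference of the product does not vanish, \<open>1 + l\<close> and \<open>N\<close> are comparable. Powers of one can then be exchanged
  for powers of the other: first to bound the differences of both factors by powers of \<open>1 / N\<close>, then
  to give the result the form required by \<open>diff_bounded\<close>.\<close>

lemma localized_samples_diff_bounded:
  assumes \<kappa>: "cutoff r \<kappa>" and "\<gamma> \<ge> 0" and "D > 0"
    and a: "\<And>i l. i \<le> r \<Longrightarrow> \<bar>fwd_diff i a l\<bar> \<le> D * (1 + real l) powr (- (\<gamma> + real i))"
  shows "\<exists>C>0. \<forall>N\<ge>1. diff_bounded r (C * N powr (- (\<gamma> + real r))) (\<lambda>l. \<kappa> ((2 * real l + 1) / N) * a l)"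
proof -
  obtain K where "K > 0" and K: "\<And>N i l. N > 0 \<Longrightarrow> i \<le> r \<Longrightarrow>
      \<bar>fwd_diff i (\<lambda>m. \<kappa> ((2 * real m + 1) / N)) l\<bar> \<le> K * (2 / N) ^ i"
    using cutoff_samples_diff_bound[OF \<kappa>] by blast
  \<comment> \<open>\<open>p\<close> is chosen such that \<open>N \<le> p (1 + l)\<close> whenever one of the samples \<open>l, \<dots>, l + r\<close> is
    nonzero.\<close>
  define p :: real where "p = 4 * real r + 4"
  have "p \<ge> 2" by (simp add: p_def)
  define C where "C = K * (D * p powr \<gamma>) * (2 * p) ^ r * p ^ r"
  have "C > 0" using \<open>K > 0\<close> \<open>D > 0\<close> \<open>p \<ge> 2\<close> by (simp add: C_def)
  have "diff_bounded r (C * N powr (- (\<gamma> + real r))) (\<lambda>l. \<kappa> ((2 * real l + 1) / N) * a l)" if "N \<ge> 1" for N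
    unfolding diff_bounded_def
  proof (intro allI impI)
    fix i l assume "i \<le> r"
    show "\<bar>fwd_diff i (\<lambda>l. \<kappa> ((2 * real l + 1) / N) * a l) l\<bar>
       \<le> C * N powr (- (\<gamma> + real r)) * (1 + real l) ^ (r - i)"
    proof (cases "2 * real l + 1 > 2 * N \<or> 2 * real (l + i) + 1 < N / 2")
      case True
      have "fwd_diff i (\<lambda>l. \<kappa> ((2 * real l + 1) / N) * a l) l = 0"
      proof (rule fwd_diff_eq_0)
        fix m assume "l \<le> m" "m \<le> l + i"
        then have "2 * real m + 1 < N / 2 \<or> 2 * real m + 1 > 2 * N"
          using True of_nat_mono[OF \<open>l \<le> m\<close>, where 'a = real] of_nat_mono[OF \<open>m \<le> l + i\<close>, where 'a = real]
          by auto
        then show "\<kappa> ((2 * real m + 1) / N) * a m = 0"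
          using cutoff_samples_eq_0[OF \<kappa>] \<open>N \<ge> 1\<close> by simp
      qed
      then show ?thesis using \<open>C > 0\<close> by simp
    next
      case False
      have "N / 2 \<le> 2 * (real l + real r) + 1" using False \<open>i \<le> r\<close> by simp
      then have "N \<le> (4 * real r + 4) + 4 * real l" by simp
      also have "\<dots> \<le> p * (1 + real l)" by (simp add: p_def algebra_simps)
      finally have Np: "N / p \<le> 1 + real l" using \<open>p \<ge> 2\<close> by (simp add: field_simps)
      have ab: "\<bar>fwd_diff i' a m\<bar> \<le> D * p powr \<gamma> * N powr (- \<gamma>) * (p / N) ^ i'" if "i' \<le> i" "l \<le> m" for i' m
      proof -
        have "(1 + real m) powr (- (\<gamma> + real i')) \<le> (N / p) powr (- (\<gamma> + real i'))"
          using Np that \<open>p \<ge> 2\<close> \<open>N \<ge> 1\<close> \<open>\<gamma> \<ge> 0\<close> by (intro powr_mono2') auto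
        also have "\<dots> = (p / N) powr (\<gamma> + real i')"
          using \<open>p \<ge> 2\<close> \<open>N \<ge> 1\<close> by (simp add: powr_minus powr_divide del: minus_add_distrib)
        also have "\<dots> = (p / N) powr \<gamma> * (p / N) ^ i'"
          using \<open>p \<ge> 2\<close> \<open>N \<ge> 1\<close> by (simp add: powr_add powr_realpow)
        also have "(p / N) powr \<gamma> = p powr \<gamma> * N powr (- \<gamma>)"
          using \<open>p \<ge> 2\<close> \<open>N \<ge> 1\<close> by (simp add: powr_divide powr_minus_divide)
        finally have *: "(1 + real m) powr (- (\<gamma> + real i')) \<le> p powr \<gamma> * N powr (- \<gamma>) * (p / N) ^ i'" .
        have "\<bar>fwd_diff i' a m\<bar> \<le> D * (1 + real m) powr (- (\<gamma> + real i'))"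
          using that \<open>i \<le> r\<close> by (intro a) auto
        also have "\<dots> \<le> D * (p powr \<gamma> * N powr (- \<gamma>) * (p / N) ^ i')"
          using * \<open>D > 0\<close> by (intro mult_left_mono) auto
        finally show ?thesis by (simp add: mult.assoc)
      qed
      have kb: "\<bar>fwd_diff i' (\<lambda>m. \<kappa> ((2 * real m + 1) / N)) m\<bar> \<le> K * (p / N) ^ i'" if "i' \<le> i" for i' m
      proof -
        have "\<bar>fwd_diff i' (\<lambda>m. \<kappa> ((2 * real m + 1) / N)) m\<bar> \<le> K * (2 / N) ^ i'"
          using that \<open>i \<le> r\<close> \<open>N \<ge> 1\<close> by (intro K) auto
        also have "\<dots> \<le> K * (p / N) ^ i'"
          using \<open>K > 0\<close> \<open>p \<ge> 2\<close> \<open>N \<ge> 1\<close> by (intro mult_left_mono power_mono divide_right_mono) auto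
        finally show ?thesis .
      qed
      have "\<bar>fwd_diff i (\<lambda>l. \<kappa> ((2 * real l + 1) / N) * a l) l\<bar>
         \<le> K * (D * p powr \<gamma> * N powr (- \<gamma>)) * (2 * (p / N)) ^ i"
        by (rule fwd_diff_mult_bound[OF kb ab])
      also have "\<dots> = K * (D * p powr \<gamma>) * (2 * p) ^ i * N powr (- \<gamma>) * (N ^ (r - i) / N ^ r)"
        using \<open>i \<le> r\<close> \<open>N \<ge> 1\<close> by (simp add: power_diff power_divide power_mult_distrib)
      also have "\<dots> = K * (D * p powr \<gamma>) * (2 * p) ^ i * N powr (- (\<gamma> + real r)) * N ^ (r - i)"
        using \<open>N \<ge> 1\<close> by (simp add: powr_minus_divide powr_add powr_realpow del: minus_add_distrib)
      also have "\<dots> \<le> K * (D * p powr \<gamma>) * (2 * p) ^ r * N powr (- (\<gamma> + real r)) * (p ^ r * (1 + real l) ^ (r - i))"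
      proof (intro mult_mono)
        have "N ^ (r - i) \<le> (p * (1 + real l)) ^ (r - i)"
          using Np \<open>p \<ge> 2\<close> \<open>N \<ge> 1\<close> by (intro power_mono) (auto simp: field_simps)
        also have "\<dots> = p ^ (r - i) * (1 + real l) ^ (r - i)" by (rule power_mult_distrib)
        also have "\<dots> \<le> p ^ r * (1 + real l) ^ (r - i)"
          using \<open>p \<ge> 2\<close> by (intro mult_right_mono power_increasing) auto
        finally show "N ^ (r - i) \<le> p ^ r * (1 + real l) ^ (r - i)" .
        show "(2 * p) ^ i \<le> (2 * p) ^ r" using \<open>p \<ge> 2\<close> \<open>i \<le> r\<close> by (intro power_increasing) auto
      qed (use \<open>K > 0\<close> \<open>D > 0\<close> \<open>p \<ge> 2\<close> \<open>N \<ge> 1\<close> in auto)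
      finally show ?thesis by (simp add: C_def mult_ac)
    qed
  qed
  with \<open>C > 0\<close> show ?thesis by blast
qed

section \<open>Localization\<close>

text \<open>With \<open>u = \<theta> / 4 \<le> \<pi> / 4\<close>, from \<open>u cos u \<le> sin u\<close> and \<open>cos\<^sup>2 u \<ge> 1 / 2\<close> it follows that
  \<open>u \<le> 2 sin u cos u = sin (\<theta> / 2)\<close>.\<close>

lemma angle_le_sqrt_one_minus_cos:
  assumes "0 \<le> \<theta>" "\<theta> \<le> pi"
  shows "\<theta> \<le> 4 * sqrt (1 - cos \<theta>)"
proof -
  define u where "u = \<theta> / 4"
  have u: "0 \<le> u" "u \<le> pi / 4" using assms by (auto simp: u_def)
  \<comment> \<open>The mean value theorem gives \<open>sin u = u cos z\<close> with \<open>z < u\<close>.\<close>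
  have "u * cos u \<le> sin u"
  proof (cases "u = 0")
    case False
    have "\<exists>z. 0 < z \<and> z < u \<and> sin u - sin 0 = (u - 0) * cos z"
      using False u by (intro MVT2) (auto intro: DERIV_sin)
    then obtain z where "0 < z" "z < u" "sin u = u * cos z" by auto
    moreover from this have "cos u \<le> cos z" using u by (intro cos_monotone_0_pi_le) auto
    ultimately show ?thesis using u by (simp add: mult_left_mono)
  qed simp
  then have "u * cos u * cos u \<le> sin u * cos u"
    using u by (intro mult_right_mono) (auto intro: cos_ge_zero)
  moreover have c: "cos u \<ge> sqrt 2 / 2"
    using u cos_monotone_0_pi_le[of u "pi / 4"] by (simp add: cos_45)
  moreover have "(sqrt 2 / 2) * (sqrt 2 / 2) \<le> cos u * cos u"
    using c by (intro mult_mono) (auto intro: order_trans[OF _ c])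
  then have "u * (1 / 2) \<le> u * (cos u * cos u)"
    using u by (intro mult_left_mono) auto
  ultimately have "u \<le> 2 * sin u * cos u" by (simp add: mult.assoc)
  also have "\<dots> = sin (2 * u)" by (simp add: sin_double)
  finally have "u\<^sup>2 \<le> (sin (2 * u))\<^sup>2" using u by (intro power_mono) auto
  also have "\<dots> = (1 - cos \<theta>) / 2"
    using cos_double_sin[of "2 * u"] by (simp add: u_def)
  finally have "\<theta>\<^sup>2 \<le> 8 * (1 - cos \<theta>)"
    by (simp add: u_def power_divide)
  then have "\<theta>\<^sup>2 \<le> 16 * (1 - cos \<theta>)"
    by (rule order_trans) (intro mult_right_mono, auto)
  then have "\<theta> \<le> sqrt (16 * (1 - cos \<theta>))" by (rule real_le_rsqrt)
  then show ?thesis by (simp only: real_sqrt_mult) simp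
qed

text \<open>The summand \<open>1\<close> of the weight is handled by the trivial bound on the sum, the summand \<open>(N \<theta>)\<^sup>r\<close> by
  \<open>legendre_sum_localized\<close>.\<close>

lemma legendre_sum_kernel_bound:
  assumes \<kappa>: "cutoff r \<kappa>" and "\<gamma> \<ge> 0" and "D > 0"
    and a: "\<And>i l. i \<le> r \<Longrightarrow> \<bar>fwd_diff i a l\<bar> \<le> D * (1 + real l) powr (- (\<gamma> + real i))"
  shows "\<exists>C>0. \<forall>j \<theta>. 0 \<le> \<theta> \<longrightarrow> \<theta> \<le> pi \<longrightarrow>
     (1 + (2 ^ j * \<theta>) ^ r) * \<bar>legendre_sum (\<lambda>l. \<kappa> ((2 * real l + 1) / 2 ^ j) * a l) (Suc (2 ^ j)) (cos \<theta>)\<bar>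
       \<le> C * (2 ^ j) powr (2 - \<gamma>)"
proof -
  obtain B where "B > 0" and B: "\<And>N. N \<ge> 1 \<Longrightarrow>
     diff_bounded r (B * N powr (- (\<gamma> + real r))) (\<lambda>l. \<kappa> ((2 * real l + 1) / N) * a l)"
    using localized_samples_diff_bounded[OF \<kappa> \<open>\<gamma> \<ge> 0\<close> \<open>D > 0\<close> a] by blast
  obtain C where "C > 0" and C: "\<And>M c L x. diff_bounded r M c \<Longrightarrow> \<forall>l\<ge>L. c l = 0 \<Longrightarrow> \<bar>x\<bar> \<le> 1 \<Longrightarrow>
     sqrt (1 - x) ^ r * \<bar>legendre_sum c L x\<bar> \<le> C * M * (real (L + r))\<^sup>2"
    using legendre_sum_localized[of r] by blast
  \<comment> \<open>With \<open>L = N + 1\<close> terms in the sum, \<open>L + r \<le> q N\<close> for all \<open>N \<ge> 1\<close>.\<close>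
  define q where "q = real r + 2"
  define E where "E = B * q ^ r * q\<^sup>2 + 4 ^ r * C * B * q\<^sup>2"
  have "q > 0" by (simp add: q_def)
  have "E > 0" unfolding E_def using \<open>B > 0\<close> \<open>C > 0\<close> \<open>q > 0\<close> by (intro add_pos_pos) auto
  have "(1 + (2 ^ j * \<theta>) ^ r) * \<bar>legendre_sum (\<lambda>l. \<kappa> ((2 * real l + 1) / 2 ^ j) * a l) (Suc (2 ^ j)) (cos \<theta>)\<bar>
       \<le> E * (2 ^ j) powr (2 - \<gamma>)" if \<theta>: "0 \<le> \<theta>" "\<theta> \<le> pi" for j \<theta>
  proof -
    define N :: real where "N = 2 ^ j"
    define L where "L = Suc (2 ^ j)"
    define M where "M = B * N powr (- (\<gamma> + real r))"
    define b where "b l = \<kappa> ((2 * real l + 1) / N) * a l" for l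
    define S where "S = \<bar>legendre_sum b L (cos \<theta>)\<bar>"
    have "N \<ge> 1" by (simp add: N_def)
    have "M > 0" using \<open>B > 0\<close> \<open>N \<ge> 1\<close> by (simp add: M_def)
    have "S \<ge> 0" by (simp add: S_def)
    have LN: "real L = N + 1" by (simp add: L_def N_def)
    have b: "diff_bounded r M b"
      unfolding M_def b_def using \<open>N \<ge> 1\<close> by (rule B)
    have supp: "\<forall>l\<ge>L. b l = 0"
    proof (intro allI impI)
      fix l assume "l \<ge> L"
      then have "real l \<ge> N + 1" using LN by (metis of_nat_le_iff)
      then show "b l = 0"
        using cutoff_samples_eq_0[OF \<kappa>, of N l] \<open>N \<ge> 1\<close> by (simp add: b_def)
    qed
    have NM: "M * N ^ r * N\<^sup>2 = B * N powr (2 - \<gamma>)"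
    proof -
      have "N ^ r * N\<^sup>2 = N powr (real r + 2)"
        using \<open>N \<ge> 1\<close> by (simp add: powr_add powr_realpow)
      then have "M * N ^ r * N\<^sup>2 = B * (N powr (- (\<gamma> + real r)) * N powr (real r + 2))"
        by (simp add: M_def)
      also have "N powr (- (\<gamma> + real r)) * N powr (real r + 2) = N powr (2 - \<gamma>)"
        by (subst powr_add[symmetric]) simp
      finally show ?thesis .
    qed
    have Lq: "real (L + r) \<le> q * N"
    proof -
      have "(real r + 1) * 1 \<le> (real r + 1) * N" using \<open>N \<ge> 1\<close> by (intro mult_left_mono) auto
      then show ?thesis using LN by (simp add: q_def algebra_simps)
    qed
    then have Lq': "(real (L + r))\<^sup>2 \<le> q\<^sup>2 * N\<^sup>2"
      using power_mono[of "real (L + r)" "q * N" 2] by (simp only: power_mult_distrib of_nat_0_le_iff)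
    have S1: "S \<le> B * q ^ r * q\<^sup>2 * N powr (2 - \<gamma>)"
    proof -
      have "S \<le> M * q ^ r * N ^ r * (real L)\<^sup>2"
        unfolding S_def
      proof (rule abs_legendre_sum_le)
        fix l assume "l < L"
        have "\<bar>b l\<bar> \<le> M * (1 + real l) ^ r"
          using b unfolding diff_bounded_def by (elim allE[of _ 0] impE allE[of _ l]) auto
        also have "\<dots> \<le> M * (q * N) ^ r"
        proof -
          have "1 + real l \<le> real L" using \<open>l < L\<close> by simp
          also have "\<dots> \<le> q * N" using Lq by simp
          finally show ?thesis using \<open>M > 0\<close> by (intro mult_left_mono power_mono) auto
        qed
        finally show "\<bar>b l\<bar> \<le> M * q ^ r * N ^ r" by (simp add: power_mult_distrib)
      qed simp
      also have "\<dots> \<le> M * q ^ r * N ^ r * (q\<^sup>2 * N\<^sup>2)"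
      proof -
        have "(real L)\<^sup>2 \<le> (real (L + r))\<^sup>2" by (intro power_mono) auto
        then have "(real L)\<^sup>2 \<le> q\<^sup>2 * N\<^sup>2" using Lq' by linarith
        then show ?thesis using \<open>M > 0\<close> \<open>q > 0\<close> \<open>N \<ge> 1\<close> by (intro mult_left_mono) auto
      qed
      also have "\<dots> = q ^ r * q\<^sup>2 * (M * N ^ r * N\<^sup>2)" by (simp add: mult_ac)
      finally show ?thesis unfolding NM by (simp add: mult_ac)
    qed
    have S2: "(N * \<theta>) ^ r * S \<le> 4 ^ r * C * B * q\<^sup>2 * N powr (2 - \<gamma>)"
    proof -
      have "\<theta> ^ r \<le> (4 * sqrt (1 - cos \<theta>)) ^ r"
        using angle_le_sqrt_one_minus_cos[OF \<theta>] \<theta> by (intro power_mono) auto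
      then have "\<theta> ^ r * S \<le> (4 * sqrt (1 - cos \<theta>)) ^ r * S"
        using \<open>S \<ge> 0\<close> by (rule mult_right_mono)
      also have "\<dots> = 4 ^ r * (sqrt (1 - cos \<theta>) ^ r * S)"
        by (simp add: power_mult_distrib)
      also have "\<dots> \<le> 4 ^ r * (C * M * (q\<^sup>2 * N\<^sup>2))"
      proof -
        have "sqrt (1 - cos \<theta>) ^ r * S \<le> C * M * (real (L + r))\<^sup>2"
          unfolding S_def by (intro C b supp) simp
        also have "\<dots> \<le> C * M * (q\<^sup>2 * N\<^sup>2)"
          using \<open>C > 0\<close> \<open>M > 0\<close> Lq' by (intro mult_left_mono) auto
        finally show ?thesis by simp
      qed
      finally have "N ^ r * (\<theta> ^ r * S) \<le> N ^ r * (4 ^ r * (C * M * (q\<^sup>2 * N\<^sup>2)))"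
        using \<open>N \<ge> 1\<close> by (intro mult_left_mono) auto
      also have "\<dots> = 4 ^ r * C * q\<^sup>2 * (M * N ^ r * N\<^sup>2)" by (simp add: mult_ac)
      finally show ?thesis unfolding NM by (simp add: power_mult_distrib mult_ac)
    qed
    have "(1 + (N * \<theta>) ^ r) * S \<le> E * N powr (2 - \<gamma>)"
      using S1 S2 by (simp add: E_def distrib_right)
    then show ?thesis by (simp add: S_def N_def L_def b_def[abs_def])
  qed
  with \<open>E > 0\<close> show ?thesis by blast
qed

theorem theorem12:
  fixes n :: "nat \<Rightarrow> nat" and w :: "nat \<Rightarrow> nat \<Rightarrow> real" and \<xi> :: "nat \<Rightarrow> nat \<Rightarrow> real ^ 3"
    and \<kappa> :: "real \<Rightarrow> real" and r :: nat and A :: "nat \<Rightarrow> real" and \<beta> c\<^sub>r :: real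
  assumes "quadrature_family n w \<xi>"
    and "cutoff r \<kappa>"
    and "\<And>l. A l > 0"
    and "summable (\<lambda>l. (2 * real l + 1) * A l)"
    and "\<beta> > 0" and "c\<^sub>r > 0"
    and "\<And>l. \<bar>fwd_diff r (\<lambda>m. sqrt (A m)) l\<bar> \<le> c\<^sub>r * (1 + real l) powr (- (1 + \<beta> + real r))"
  shows "\<exists>C>0. \<forall>j. \<forall>k\<in>{1..n j}. \<forall>s\<in>S2.
           \<bar>needlet \<kappa> A j (w j k) (\<xi> j k) s\<bar>
             \<le> C * 2 powr (- \<beta> * real j) / (1 + (2 ^ j * geodist s (\<xi> j k)) ^ r)"
proof -
  define a where "a l = sqrt (A l)" for l
  have "summable A"
  proof (rule summable_comparison_test'[OF assms(4), of 0])
    fix l show "norm (A l) \<le> (2 * real l + 1) * A l"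
      using assms(3)[of l] by (simp add: algebra_simps)
  qed
  then have "a \<longlonglongrightarrow> sqrt 0"
    unfolding a_def by (intro tendsto_real_sqrt summable_LIMSEQ_zero)
  then obtain D where "D > 0" and D: "\<And>i l. i \<le> r \<Longrightarrow> \<bar>fwd_diff i a l\<bar> \<le> D * (1 + real l) powr (- ((1 + \<beta>) + real i))"
    using lower_differences_decay[of a \<beta> r c\<^sub>r] assms(5,7) unfolding a_def[symmetric] by auto
  obtain C where "C > 0" and C: "\<And>j \<theta>. 0 \<le> \<theta> \<Longrightarrow> \<theta> \<le> pi \<Longrightarrow>
     (1 + (2 ^ j * \<theta>) ^ r) * \<bar>legendre_sum (\<lambda>l. \<kappa> ((2 * real l + 1) / 2 ^ j) * a l) (Suc (2 ^ j)) (cos \<theta>)\<bar>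
       \<le> C * (2 ^ j) powr (2 - (1 + \<beta>))"
    using legendre_sum_kernel_bound[OF assms(2) _ \<open>D > 0\<close> D] assms(5) by auto
  obtain c where "c > 0" and c: "\<And>j k. k \<in> {1..n j} \<Longrightarrow> 0 < w j k \<and> w j k \<le> c / 2 ^ (2 * j) \<and> \<xi> j k \<in> S2"
    using assms(1) unfolding quadrature_family_def by metis
  have "\<bar>needlet \<kappa> A j (w j k) (\<xi> j k) s\<bar>
      \<le> (sqrt c * C) * 2 powr (- \<beta> * real j) / (1 + (2 ^ j * geodist s (\<xi> j k)) ^ r)"
    if k: "k \<in> {1..n j}" and s: "s \<in> S2" for j k s
  proof -
    define \<theta> where "\<theta> = geodist s (\<xi> j k)"
    define b where "b l = \<kappa> ((2 * real l + 1) / 2 ^ j) * a l" for l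
    have "\<bar>s \<bullet> \<xi> j k\<bar> \<le> 1"
      using Cauchy_Schwarz_ineq2[of s "\<xi> j k"] s c[OF k] by simp
    then have \<theta>: "0 \<le> \<theta>" "\<theta> \<le> pi" and cos: "cos \<theta> = s \<bullet> \<xi> j k"
      unfolding \<theta>_def geodist_def by (auto intro: arccos_lbound arccos_ubound cos_arccos_abs)
    have "b l = 0" if "l \<notin> {..<Suc (2 ^ j)}" for l
    proof -
      have "real l \<ge> real (Suc (2 ^ j))" using that by (simp only: of_nat_le_iff) simp
      then show ?thesis
        using cutoff_samples_eq_0[OF assms(2), of "2 ^ j" l] by (simp add: b_def)
    qed
    then have "(\<Sum>l. b l * ((2 * real l + 1) / (4 * pi)) * poly (legendre_poly l) (s \<bullet> \<xi> j k))
        = (\<Sum>l<Suc (2 ^ j). b l * ((2 * real l + 1) / (4 * pi)) * poly (legendre_poly l) (s \<bullet> \<xi> j k))"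
      by (intro suminf_finite) auto
    also have "\<dots> = legendre_sum b (Suc (2 ^ j)) (cos \<theta>) / (4 * pi)"
      unfolding legendre_sum_def cos sum_divide_distrib by (intro sum.cong) auto
    finally have "\<bar>needlet \<kappa> A j (w j k) (\<xi> j k) s\<bar>
        = sqrt (w j k) * (\<bar>legendre_sum b (Suc (2 ^ j)) (cos \<theta>)\<bar> / (4 * pi))"
      using c[OF k] by (simp add: needlet_def b_def a_def abs_mult)
    also have "\<dots> \<le> (sqrt c / 2 ^ j) * \<bar>legendre_sum b (Suc (2 ^ j)) (cos \<theta>)\<bar>"
    proof (intro mult_mono)
      have "sqrt (w j k) \<le> sqrt (c / (2 ^ j)\<^sup>2)"
        using c[OF k] by (simp add: power_even_eq)
      then show "sqrt (w j k) \<le> sqrt c / 2 ^ j" by (simp only: real_sqrt_divide real_sqrt_abs) simp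
      have "4 * pi \<ge> 1" using pi_gt3 by simp
      then have "\<bar>legendre_sum b (Suc (2 ^ j)) (cos \<theta>)\<bar> / (4 * pi) \<le> \<bar>legendre_sum b (Suc (2 ^ j)) (cos \<theta>)\<bar> / 1"
        by (intro divide_left_mono) auto
      then show "\<bar>legendre_sum b (Suc (2 ^ j)) (cos \<theta>)\<bar> / (4 * pi) \<le> \<bar>legendre_sum b (Suc (2 ^ j)) (cos \<theta>)\<bar>"
        by simp
    qed (use \<open>c > 0\<close> in auto)
    finally have 1: "\<bar>needlet \<kappa> A j (w j k) (\<xi> j k) s\<bar> \<le> (sqrt c / 2 ^ j) * \<bar>legendre_sum b (Suc (2 ^ j)) (cos \<theta>)\<bar>" .
    have pos: "1 + (2 ^ j * \<theta>) ^ r > 0" using \<theta> by (intro add_pos_nonneg) auto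
    have "\<bar>needlet \<kappa> A j (w j k) (\<xi> j k) s\<bar> * (1 + (2 ^ j * \<theta>) ^ r)
        \<le> (sqrt c / 2 ^ j) * ((1 + (2 ^ j * \<theta>) ^ r) * \<bar>legendre_sum b (Suc (2 ^ j)) (cos \<theta>)\<bar>)"
      using mult_right_mono[OF 1 less_imp_le[OF pos]] by (simp add: mult_ac)
    also have "\<dots> \<le> (sqrt c / 2 ^ j) * (C * (2 ^ j) powr (2 - (1 + \<beta>)))"
      unfolding b_def using \<open>c > 0\<close> by (intro mult_left_mono C \<theta>) auto
    also have "\<dots> = sqrt c * C * 2 powr (- \<beta> * real j)"
    proof -
      have "(2 ^ j) powr (2 - (1 + \<beta>)) = (2 ^ j) powr 1 * ((2 ^ j :: real) powr (- \<beta>))"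
        by (subst powr_add[symmetric]) simp
      also have "(2 ^ j :: real) powr (- \<beta>) = 2 powr (- \<beta> * real j)"
        by (simp add: powr_realpow[symmetric] powr_powr mult.commute)
      finally show ?thesis by simp
    qed
    finally show ?thesis using pos by (simp add: pos_le_divide_eq \<theta>_def)
  qed
  then show ?thesis using \<open>c > 0\<close> \<open>C > 0\<close> by (intro exI[of _ "sqrt c * C"]) auto
qed

end
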